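(* Let $\phi:\mathbb{Z}\to\mathbb{C}$ have admissible support and let $A=\sup_{\xi\in\mathbb{R}}|\hat{\phi}(\xi)|$. Then there is a natural number $m\geq 2$ and positive constants $C$ and $C'$ such that $$Cn^{-1/m}\leq A^{-n}\|\phi^{(n)}\|_{\infty}\leq C'n^{-1/m}$$ for all natural numbers $n$.
   Context: A function $\phi:\mathbb{Z}\to\mathbb{C}$ has admissible support if its support is finite and consists of more than one point. The convolution powers are $\phi^{(1)}=\phi$ and $\phi^{(n)}(x)=\sum_{y\in\mathbb{Z}}\phi^{(n-1)}(x-y)\phi(y)$ for $n\ge 2$. The Fourier transform of a finitely supported $\phi$ is $\hat{\phi}:\mathbb{R}\to\mathbb{C}$, $\hat{\phi}(\xi)=\sum_{x\in\mathbb{Z}}\phi(x)e^{ix\xi}$. $\|\phi^{(n)}\|_\infty=\sup_{x\in\mathbb{Z}}|\phi^{(n)}(x)|$. Natural numbers are the positive integers. *)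

theory Defs
  imports "HOL-Analysis.Analysis"
begin

definition supp :: "(int \<Rightarrow> complex) \<Rightarrow> int set" where
  "supp \<phi> = {x. \<phi> x \<noteq> 0}"

definition admissible_support :: "(int \<Rightarrow> complex) \<Rightarrow> bool" where
  "admissible_support \<phi> \<longleftrightarrow> finite (supp \<phi>) \<and> card (supp \<phi>) > 1"

(* Convolution powers start at exponent 1. The value at exponent 0, the convolution
   identity, only makes the function total. *)
fun conv_power :: "(int \<Rightarrow> complex) \<Rightarrow> nat \<Rightarrow> int \<Rightarrow> complex" where
  "conv_power \<phi> 0 x = (if x = 0 then 1 else 0)"
| "conv_power \<phi> (Suc 0) x = \<phi> x"
| "conv_power \<phi> (Suc (Suc n)) x = (\<Sum>\<^sub>\<infinity>y. conv_power \<phi> (Suc n) (x - y) * \<phi> y)"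

(* The sign in the exponent is positive and there is no normalising factor. For finitely
   supported \<phi> the sum has only finitely many nonzero terms. *)
definition fourier :: "(int \<Rightarrow> complex) \<Rightarrow> real \<Rightarrow> complex" where
  "fourier \<phi> \<xi> = (\<Sum>\<^sub>\<infinity>x. \<phi> x * exp (\<i> * of_int x * of_real \<xi>))"

(* Meaningful for bounded functions only, since SUP on real is unspecified on unbounded sets. *)
definition sup_norm :: "('a \<Rightarrow> complex) \<Rightarrow> real" where
  "sup_norm f = (SUP x. norm (f x))"

end

theory Submission
  imports Defs "HOL-Complex_Analysis.Complex_Analysis"
begin

text \<open>
  Let \<open>f\<close> be the transform of \<open>\<phi>\<close> and \<open>u = f / A\<close>, so \<open>norm u \<le> 1\<close>. By \<open>fourier_conv_power\<close> and
  \<open>fourier_inversion\<close>, the number \<open>2 * pi * conv_power \<phi> n x / A^n\<close> is the integral of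
  \<open>u \<xi>^n * exp (- \<i> * x * \<xi>)\<close> over a period. For large \<open>n\<close> it is governed by the points at which
  \<open>norm u = 1\<close>.

  At such a point \<open>\<xi>\<^sub>0\<close> let \<open>L = u' / u\<close>. Since \<open>norm u\<close> is maximal, \<open>L \<xi>\<^sub>0 = \<i> * \<alpha>\<close> with
  \<open>\<alpha>\<close> real. Since \<open>\<phi>\<close> is not concentrated in one point, \<open>f\<close> is not an exponential, so \<open>L'\<close>
  vanishes at \<open>\<xi>\<^sub>0\<close> to a finite order \<open>k\<close> (\<open>log_derivative_factorization\<close>). Put \<open>m = k + 2\<close>; then
  \<open>u (\<xi>\<^sub>0 + t)\<close> differs from \<open>u \<xi>\<^sub>0 * exp (\<i> * \<alpha> * t)\<close> by a term of order \<open>t^m\<close>. Everything happens at the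
  scale \<open>d = n powr (- 1 / m)\<close>.

  Lower bound: on a window of length a small multiple of \<open>d\<close>, the function \<open>f^n\<close> is close to one wave
  of amplitude \<open>A^n\<close> and integer frequency. Testing against a bump supported in the window shows that
  some coefficient of \<open>f^n\<close> has size at least a multiple of \<open>A^n * d\<close> (\<open>coefficient_lower_bound\<close>).

  Upper bound: near \<open>\<xi>\<^sub>0\<close>, the part of the integral within distance \<open>d\<close> is at most \<open>2 * d\<close>, and the rest
  is handled by a second derivative test (\<open>complex_van_der_Corput\<close>). The derivative of \<open>n * L\<close> has
  size about \<open>n * d^k = 1 / d^2\<close> or more there, and after multiplication by a constant of modulus 1 it
  stays near the positive real axis. Only this is used, along with \<open>norm u \<le> 1\<close>; it makes no
  difference whether the leading term of the expansion makes \<open>norm u\<close> decay or makes \<open>u\<close> oscillate.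

  To combine the local estimates, call an exponent good for an interval if the lower bound holds with
  it and the integrals over the interval obey the upper bound with it. For adjacent intervals the
  larger of two good exponents is good for the union, since the upper bound becomes weaker as the
  exponent grows and the lower bound does not refer to the interval. Every point has a neighbourhood
  with a good exponent: the order at a maximum point, and any exponent with a lower bound elsewhere.
  The bisection principle \<open>Bolzano\<close> then gives a good exponent for the whole period.
\<close>

section \<open>Fourier transforms of convolution powers\<close>

lemma fourier_eq_sum:
  assumes "finite T" "supp c \<subseteq> T"
  shows "fourier c \<xi> = (\<Sum>x\<in>T. c x * exp (\<i> * of_int x * of_real \<xi>))"
proof -
  have "fourier c \<xi> = (\<Sum>\<^sub>\<infinity>x\<in>T. c x * exp (\<i> * of_int x * of_real \<xi>))"
    unfolding fourier_def
    by (rule infsum_cong_neutral) (use assms in \<open>auto simp: supp_def\<close>)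
  then show ?thesis using assms by simp
qed

lemma conv_power_Suc:
  assumes "finite (supp \<phi>)"
  shows "conv_power \<phi> (Suc n) x = (\<Sum>y\<in>supp \<phi>. conv_power \<phi> n (x - y) * \<phi> y)"
proof (cases n)
  case 0
  have "(\<Sum>y\<in>supp \<phi>. conv_power \<phi> 0 (x - y) * \<phi> y) = (\<Sum>y\<in>supp \<phi>. if y = x then \<phi> x else 0)"
    by (rule sum.cong) auto
  then show ?thesis using 0 assms by (auto simp: supp_def)
next
  case (Suc k)
  have "conv_power \<phi> (Suc n) x = (\<Sum>\<^sub>\<infinity>y\<in>supp \<phi>. conv_power \<phi> n (x - y) * \<phi> y)"
    unfolding Suc conv_power.simps
    by (rule infsum_cong_neutral) (auto simp: supp_def)
  then show ?thesis using assms by simp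
qed

lemma finite_supp_conv_power:
  assumes "finite (supp \<phi>)"
  shows "finite (supp (conv_power \<phi> n))"
proof (induction n)
  case 0
  show ?case by (rule finite_subset[of _ "{0}"]) (auto simp: supp_def)
next
  case (Suc n)
  have "supp (conv_power \<phi> (Suc n)) \<subseteq> (\<lambda>(x, y). x + y) ` (supp (conv_power \<phi> n) \<times> supp \<phi>)"
  proof
    fix x assume "x \<in> supp (conv_power \<phi> (Suc n))"
    then have "(\<Sum>y\<in>supp \<phi>. conv_power \<phi> n (x - y) * \<phi> y) \<noteq> 0"
      using conv_power_Suc[OF assms, of n x] by (auto simp: supp_def[of "conv_power \<phi> (Suc n)"])
    then obtain y where "y \<in> supp \<phi>" "conv_power \<phi> n (x - y) * \<phi> y \<noteq> 0"
      by (metis (no_types, lifting) sum.neutral)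
    then show "x \<in> (\<lambda>(x, y). x + y) ` (supp (conv_power \<phi> n) \<times> supp \<phi>)"
      by (intro image_eqI[of _ _ "(x - y, y)"]) (auto simp: supp_def)
  qed
  then show ?case
    by (rule finite_subset) (use Suc assms in auto)
qed

text \<open>
  The transform turns convolution into multiplication; this also holds for the exponent 0, which
  starts the induction.
\<close>
lemma fourier_conv_power:
  assumes "finite (supp \<phi>)"
  shows "fourier (conv_power \<phi> n) \<xi> = fourier \<phi> \<xi> ^ n"
proof (induction n)
  case 0
  have "supp (conv_power \<phi> 0) \<subseteq> {0}"
    by (auto simp: supp_def)
  then show ?case
    by (subst fourier_eq_sum[of "{0}"]) auto
next
  case (Suc n)
  define e where "e = (\<lambda>x::int. exp (\<i> * of_int x * of_real \<xi>))"
  have e_add: "e (x + y) = e x * e y" for x y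
    by (simp add: e_def exp_add[symmetric] algebra_simps)
  define c where "c = conv_power \<phi> n"
  define T where "T = (\<lambda>(x, y). x + y) ` (supp c \<times> supp \<phi>) \<union> supp (conv_power \<phi> (Suc n))"
  have fc: "finite (supp c)"
    unfolding c_def using assms by (rule finite_supp_conv_power)
  have T: "finite T"
    unfolding T_def using fc assms finite_supp_conv_power by auto
  have inner: "(\<Sum>x\<in>T. c (x - y) * e x) = e y * fourier c \<xi>" if y: "y \<in> supp \<phi>" for y
  proof -
    have "(\<Sum>x\<in>T. c (x - y) * e x) = (\<Sum>z\<in>(\<lambda>x. x - y) ` T. c z * e (z + y))"
      by (subst sum.reindex) (auto simp: inj_on_def)
    also have "\<dots> = e y * (\<Sum>z\<in>(\<lambda>x. x - y) ` T. c z * e z)"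
      by (simp add: e_add sum_distrib_left mult_ac)
    also have "(\<Sum>z\<in>(\<lambda>x. x - y) ` T. c z * e z) = fourier c \<xi>"
      unfolding e_def
    proof (rule fourier_eq_sum[symmetric])
      show "supp c \<subseteq> (\<lambda>x. x - y) ` T"
      proof
        fix z assume "z \<in> supp c"
        then have "z + y \<in> T" using y by (auto simp: T_def)
        then show "z \<in> (\<lambda>x. x - y) ` T" by (intro image_eqI[of _ _ "z + y"]) auto
      qed
    qed (use T in auto)
    finally show ?thesis .
  qed
  have "fourier (conv_power \<phi> (Suc n)) \<xi> = (\<Sum>x\<in>T. conv_power \<phi> (Suc n) x * e x)"
    unfolding e_def using T by (intro fourier_eq_sum) (auto simp: T_def)
  also have "\<dots> = (\<Sum>x\<in>T. \<Sum>y\<in>supp \<phi>. c (x - y) * \<phi> y * e x)"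
    by (simp add: conv_power_Suc[OF assms] c_def sum_distrib_right del: conv_power.simps)
  also have "\<dots> = (\<Sum>y\<in>supp \<phi>. \<phi> y * (\<Sum>x\<in>T. c (x - y) * e x))"
    by (subst sum.swap) (simp add: sum_distrib_left mult_ac)
  also have "\<dots> = (\<Sum>y\<in>supp \<phi>. \<phi> y * e y) * fourier c \<xi>"
    by (simp add: inner sum_distrib_right mult.assoc)
  also have "(\<Sum>y\<in>supp \<phi>. \<phi> y * e y) = fourier \<phi> \<xi>"
    unfolding e_def using assms by (intro fourier_eq_sum[symmetric]) auto
  finally show ?case using Suc by (simp add: c_def)
qed

lemma exp_int_has_integral:
  fixes k :: int
  shows "((\<lambda>\<xi>. exp (\<i> * of_int k * of_real \<xi>)) has_integral (if k = 0 then 2 * pi else 0)) {0..2 * pi}"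
proof (cases "k = 0")
  case True
  then show ?thesis using has_integral_const_real[of "1::complex" 0 "2*pi"] by (simp add: scaleR_conv_of_real)
next
  case False
  define F where "F = (\<lambda>\<xi>::real. exp (\<i> * of_int k * of_real \<xi>) / (\<i> * of_int k))"
  have "((\<lambda>\<xi>. exp (\<i> * of_int k * of_real \<xi>)) has_integral (F (2 * pi) - F 0)) {0..2 * pi}"
  proof (rule fundamental_theorem_of_calculus)
    fix x :: real
    show "(F has_vector_derivative exp (\<i> * of_int k * of_real x)) (at x within {0..2 * pi})"
      unfolding F_def using False
      by (intro has_vector_derivative_real_field) (auto intro!: derivative_eq_intros simp: field_simps)
  qed simp
  moreover have "exp (\<i> * of_int k * of_real (2 * pi)) = 1"
    unfolding exp_eq_1 by (auto intro!: exI[of _ k])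
  ultimately show ?thesis using False by (simp add: F_def)
qed

text \<open>
  Orthogonality of the characters recovers each coefficient from the transform. Applied to a
  convolution power it gives the integral representation that the upper bound estimates.
\<close>
lemma fourier_inversion:
  fixes c :: "int \<Rightarrow> complex"
  assumes "finite (supp c)"
  shows "((\<lambda>\<xi>. fourier c \<xi> * exp (- (\<i> * of_int x * of_real \<xi>))) has_integral 2 * pi * c x) {0..2 * pi}"
proof -
  have "(\<lambda>\<xi>. fourier c \<xi> * exp (- (\<i> * of_int x * of_real \<xi>))) =
      (\<lambda>\<xi>. \<Sum>y\<in>supp c. c y * exp (\<i> * of_int (y - x) * of_real \<xi>))"
  proof
    fix \<xi> :: real
    have "exp (\<i> * of_int y * of_real \<xi>) * exp (- (\<i> * of_int x * of_real \<xi>)) =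
        exp (\<i> * of_int (y - x) * of_real \<xi>)" for y
      by (simp add: exp_add[symmetric] algebra_simps)
    then show "fourier c \<xi> * exp (- (\<i> * of_int x * of_real \<xi>)) =
        (\<Sum>y\<in>supp c. c y * exp (\<i> * of_int (y - x) * of_real \<xi>))"
      unfolding fourier_eq_sum[OF assms order_refl] sum_distrib_right
      by (simp only: mult.assoc[of "c _"])
  qed
  moreover have "((\<lambda>\<xi>. \<Sum>y\<in>supp c. c y * exp (\<i> * of_int (y - x) * of_real \<xi>)) has_integral
      (\<Sum>y\<in>supp c. c y * of_real (if y - x = 0 then 2 * pi else 0))) {0..2 * pi}"
    by (intro has_integral_sum has_integral_mult_right exp_int_has_integral assms)
  moreover have "(\<Sum>y\<in>supp c. c y * of_real (if y - x = 0 then 2 * pi else 0)) =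
      (\<Sum>y\<in>supp c. if y = x then 2 * pi * c x else 0)"
    by (rule sum.cong) auto
  moreover have "\<dots> = 2 * pi * c x"
    using assms by (auto simp: supp_def)
  ultimately show ?thesis by simp
qed

text \<open>
  The supremum on \<open>real\<close> is meaningful here because a finitely supported function is bounded.
\<close>
lemma norm_le_sup_norm:
  assumes "finite (supp c)"
  shows "norm (c x) \<le> sup_norm c"
proof -
  have "norm (c y) \<le> (\<Sum>z\<in>supp c. norm (c z))" for y
  proof (cases "y \<in> supp c")
    case True
    then show ?thesis using assms by (intro member_le_sum) auto
  qed (auto simp: supp_def sum_nonneg)
  then show ?thesis unfolding sup_norm_def by (intro cSUP_upper bdd_aboveI2) auto
qed

text \<open>
  By periodicity it suffices to look at one compact period.
\<close>
lemma fourier_attains_max: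
  assumes "finite (supp \<phi>)"
  obtains \<xi>\<^sub>0 where "\<And>\<xi>. norm (fourier \<phi> \<xi>) \<le> norm (fourier \<phi> \<xi>\<^sub>0)"
proof -
  have cont: "continuous_on S (fourier \<phi>)" for S
    unfolding fourier_eq_sum[OF assms order_refl] by (intro continuous_intros)
  obtain \<xi>\<^sub>0 where \<xi>\<^sub>0: "\<And>\<xi>. \<xi> \<in> {0..2 * pi} \<Longrightarrow> norm (fourier \<phi> \<xi>) \<le> norm (fourier \<phi> \<xi>\<^sub>0)"
    using continuous_attains_sup[of "{0..2 * pi}" "\<lambda>\<xi>. norm (fourier \<phi> \<xi>)"]
    by (force intro: continuous_on_norm cont)
  have "norm (fourier \<phi> \<xi>) \<le> norm (fourier \<phi> \<xi>\<^sub>0)" for \<xi>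
  proof -
    define j where "j = \<lfloor>\<xi> / (2 * pi)\<rfloor>"
    define t where "t = \<xi> - 2 * pi * of_int j"
    have "of_int j \<le> \<xi> / (2 * pi)" "\<xi> / (2 * pi) \<le> of_int j + 1"
      unfolding j_def using floor_correct[of "\<xi> / (2 * pi)"] by (auto simp del: divide_less_eq)
    then have "of_int j * (2 * pi) \<le> \<xi>" "\<xi> \<le> (of_int j + 1) * (2 * pi)"
      by (simp_all only: pos_le_divide_eq pos_divide_le_eq pi_gt_zero zero_less_mult_iff zero_less_numeral simp_thms)
    then have "t \<in> {0..2 * pi}" by (simp add: t_def algebra_simps)
    moreover have "fourier \<phi> \<xi> = fourier \<phi> t"
    proof -
      have "exp (\<i> * of_int x * of_real \<xi>) = exp (\<i> * of_int x * of_real t)" for x :: int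
        unfolding exp_eq by (intro exI[of _ "x * j"]) (simp add: t_def algebra_simps)
      then show ?thesis unfolding fourier_eq_sum[OF assms order_refl] by simp
    qed
    ultimately show ?thesis using \<xi>\<^sub>0 by simp
  qed
  then show thesis using that by blast
qed

section \<open>The entire extension of the transform\<close>

text \<open>
  The transform extends to an entire function of a complex variable. This makes the order of
  vanishing of derived functions at a real point available.
\<close>
definition fourier_ext :: "(int \<Rightarrow> complex) \<Rightarrow> complex \<Rightarrow> complex" where
  "fourier_ext c z = (\<Sum>x\<in>supp c. c x * exp (\<i> * of_int x * z))"

lemma fourier_eq_fourier_ext:
  assumes "finite (supp c)"
  shows "fourier c \<xi> = fourier_ext c (of_real \<xi>)"
  unfolding fourier_ext_def using assms by (rule fourier_eq_sum) simp

lemma fourier_ext_deriv: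
  "(fourier_ext c has_field_derivative
     (\<Sum>x\<in>supp c. c x * (\<i> * of_int x) * exp (\<i> * of_int x * z))) (at z)"
  unfolding fourier_ext_def
  by (rule derivative_eq_intros refl)+ (simp add: mult_ac)

lemma holomorphic_fourier_ext: "fourier_ext c holomorphic_on S"
  using fourier_ext_deriv by (meson holomorphic_on_def field_differentiable_def field_differentiable_at_within)

text \<open>
  An entire function \<open>F\<close> with \<open>F' = \<mu> * F\<close> is a multiple of one exponential. In terms of coefficients, \<open>\<phi> x * (\<i> * x - \<mu>)\<close> would have zero transform and hence vanish, so \<open>\<phi>\<close> would live on a
  single point.
\<close>
lemma fourier_ext_not_exponential:
  assumes "admissible_support \<phi>"
  obtains z where "deriv (fourier_ext \<phi>) z \<noteq> \<mu> * fourier_ext \<phi> z"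
proof -
  have fin: "finite (supp \<phi>)" and card: "card (supp \<phi>) > 1"
    using assms by (auto simp: admissible_support_def)
  have "False" if eq: "\<And>z. deriv (fourier_ext \<phi>) z = \<mu> * fourier_ext \<phi> z"
  proof -
    define c where "c = (\<lambda>x. \<phi> x * (\<i> * of_int x - \<mu>))"
    have sub: "supp c \<subseteq> supp \<phi>" by (auto simp: c_def supp_def)
    then have finc: "finite (supp c)" using fin finite_subset by blast
    have "fourier c \<xi> = 0" for \<xi>
    proof -
      have "fourier c \<xi> = (\<Sum>x\<in>supp \<phi>. c x * exp (\<i> * of_int x * of_real \<xi>))"
        by (rule fourier_eq_sum[OF fin sub])
      also have "\<dots> = deriv (fourier_ext \<phi>) (of_real \<xi>) - \<mu> * fourier_ext \<phi> (of_real \<xi>)"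
        unfolding DERIV_imp_deriv[OF fourier_ext_deriv] unfolding fourier_ext_def c_def
        by (simp add: sum_distrib_left sum_subtractf[symmetric] algebra_simps)
      finally show ?thesis using eq by simp
    qed
    then have "c x = 0" for x
      using has_integral_unique[OF fourier_inversion[OF finc, of x]] has_integral_0 by force
    then have "\<And>x. x \<in> supp \<phi> \<Longrightarrow> \<i> * of_int x = \<mu>" by (auto simp: c_def supp_def)
    then have "\<forall>x\<in>supp \<phi>. \<forall>y\<in>supp \<phi>. x = y"
      by (metis complex_i_not_zero mult_left_cancel of_int_eq_iff)
    then have "card (supp \<phi>) \<le> 1" using card_le_Suc0_iff_eq[OF fin] by auto
    then show False using card by simp
  qed
  then show thesis using that by blast
qed

text \<open>
  The logarithmic derivative \<open>L\<close> of the entire extension is holomorphic near a point where the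
  transform does not vanish. Its derivative is not identically zero, since otherwise the extension
  would be an exponential on a disc, hence everywhere. So \<open>L'\<close> has an order of vanishing \<open>k\<close>,
  possibly 0, and splitting off \<open>(\<xi> - \<xi>\<^sub>0)^k\<close> leaves a nonzero value of the cofactor \<open>\<kappa>\<close>. The exponent of
  the theorem will come from \<open>k + 2\<close>.
\<close>
lemma log_derivative_factorization:
  assumes adm: "admissible_support \<phi>" and f0: "fourier \<phi> \<xi>\<^sub>0 \<noteq> 0"
  obtains r k and L \<kappa> :: "real \<Rightarrow> complex" where "r > 0"
    "\<And>\<xi>. \<xi> \<in> {\<xi>\<^sub>0 - r..\<xi>\<^sub>0 + r} \<Longrightarrow>
      (fourier \<phi> has_vector_derivative L \<xi> * fourier \<phi> \<xi>) (at \<xi>)"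
    "\<And>\<xi>. \<xi> \<in> {\<xi>\<^sub>0 - r..\<xi>\<^sub>0 + r} \<Longrightarrow>
      (L has_vector_derivative of_real ((\<xi> - \<xi>\<^sub>0)^k) * \<kappa> \<xi>) (at \<xi>)"
    "continuous_on {\<xi>\<^sub>0 - r..\<xi>\<^sub>0 + r} \<kappa>" "\<kappa> \<xi>\<^sub>0 \<noteq> 0"
proof -
  have fin: "finite (supp \<phi>)" using adm by (simp add: admissible_support_def)
  define F where "F = fourier_ext \<phi>"
  define z0 where "z0 = complex_of_real \<xi>\<^sub>0"
  have fF: "fourier \<phi> = (\<lambda>\<xi>. F (of_real \<xi>))"
    unfolding F_def by (rule ext) (rule fourier_eq_fourier_ext[OF fin])
  have holF: "F holomorphic_on S" for S unfolding F_def by (rule holomorphic_fourier_ext)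
  have "isCont F z0"
    using holF[of UNIV] holomorphic_on_imp_continuous_on[of F UNIV] by (simp add: continuous_on_eq_continuous_at)
  moreover have "F z0 \<noteq> 0" using f0 by (simp add: fF z0_def)
  ultimately obtain e where e: "e > 0" "\<And>z. dist z0 z < e \<Longrightarrow> F z \<noteq> 0"
    using continuous_at_avoid[of z0 F 0] by blast
  define S where "S = ball z0 e"
  have F0: "F z \<noteq> 0" if "z \<in> S" for z using e(2) that by (auto simp: S_def)
  define Lc where "Lc = (\<lambda>z. deriv F z / F z)"
  have openS: "open S" and z0S: "z0 \<in> S" using e by (auto simp: S_def)
  have holL: "Lc holomorphic_on S"
    unfolding Lc_def using F0 by (intro holomorphic_intros holF holomorphic_deriv openS)
  have holD: "deriv Lc holomorphic_on S" by (rule holomorphic_deriv[OF holL openS])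
  have "\<exists>w\<in>S. deriv Lc w \<noteq> 0"
  proof (rule ccontr)
    assume "\<not> ?thesis"
    then have "(Lc has_field_derivative 0) (at z within S)" if "z \<in> S" for z
      using holomorphic_derivI[OF holL openS that] that by (auto intro: has_field_derivative_at_within)
    then obtain \<mu> where \<mu>: "\<And>z. z \<in> S \<Longrightarrow> Lc z = \<mu>"
      using has_field_derivative_zero_constant[of S Lc] by (auto simp: S_def)
    have "deriv F z = \<mu> * F z" for z
    proof (rule analytic_continuation_open[of S UNIV "deriv F" "\<lambda>z. \<mu> * F z"])
      show "\<And>z. z \<in> S \<Longrightarrow> deriv F z = \<mu> * F z"
        using \<mu> F0 by (auto simp: Lc_def field_simps)
    qed (use openS z0S in \<open>auto intro!: holomorphic_intros holF holomorphic_deriv\<close>)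
    then show False using fourier_ext_not_exponential[OF adm] by (metis F_def)
  qed
  then obtain r where r: "r > 0" "cball z0 r \<subseteq> S" "zor_poly (deriv Lc) z0 holomorphic_on cball z0 r"
    "\<And>w. w \<in> cball z0 r \<Longrightarrow> deriv Lc w = zor_poly (deriv Lc) z0 w * (w - z0) ^ nat (zorder (deriv Lc) z0)"
    "\<And>w. w \<in> cball z0 r \<Longrightarrow> zor_poly (deriv Lc) z0 w \<noteq> 0"
  proof -
    have "connected S" by (simp add: S_def)
    from zorder_exist_zero[OF holD openS this z0S \<open>\<exists>w\<in>S. deriv Lc w \<noteq> 0\<close>] show ?thesis
      using that by blast
  qed
  have in_cball: "of_real \<xi> \<in> cball z0 r" if "\<xi> \<in> {\<xi>\<^sub>0 - r..\<xi>\<^sub>0 + r}" for \<xi>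
    using that by (auto simp: z0_def dist_norm simp flip: of_real_diff)
  show thesis
  proof (rule that[of r "\<lambda>\<xi>. Lc (of_real \<xi>)" "nat (zorder (deriv Lc) z0)"
        "\<lambda>\<xi>. zor_poly (deriv Lc) z0 (of_real \<xi>)"])
    show "r > 0" by fact
    show "zor_poly (deriv Lc) z0 (of_real \<xi>\<^sub>0) \<noteq> 0" using r(5)[of z0] r(1) by (simp add: z0_def)
    show "continuous_on {\<xi>\<^sub>0 - r..\<xi>\<^sub>0 + r} (\<lambda>\<xi>. zor_poly (deriv Lc) z0 (of_real \<xi>))"
      by (rule continuous_on_compose2[OF holomorphic_on_imp_continuous_on[OF r(3)]])
         (use in_cball in \<open>auto intro: continuous_intros\<close>)
    fix \<xi> assume \<xi>: "\<xi> \<in> {\<xi>\<^sub>0 - r..\<xi>\<^sub>0 + r}"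
    note c = in_cball[OF \<xi>]
    then have S: "of_real \<xi> \<in> S" using r(2) by blast
    have "(F has_field_derivative Lc (of_real \<xi>) * F (of_real \<xi>)) (at (of_real \<xi>))"
      using holomorphic_derivI[OF holF openS S] F0[OF S] by (simp add: Lc_def)
    then show "(fourier \<phi> has_vector_derivative Lc (of_real \<xi>) * fourier \<phi> \<xi>) (at \<xi>)"
      unfolding fF by (rule has_vector_derivative_real_field)
    have "deriv Lc (of_real \<xi>) = of_real ((\<xi> - \<xi>\<^sub>0) ^ nat (zorder (deriv Lc) z0)) * zor_poly (deriv Lc) z0 (of_real \<xi>)"
      unfolding r(4)[OF c] by (simp add: z0_def)
    then show "((\<lambda>\<xi>. Lc (of_real \<xi>)) has_vector_derivative
        of_real ((\<xi> - \<xi>\<^sub>0) ^ nat (zorder (deriv Lc) z0)) * zor_poly (deriv Lc) z0 (of_real \<xi>)) (at \<xi>)"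
      using holomorphic_derivI[OF holL openS S] by (metis has_vector_derivative_real_field)
  qed
qed

section \<open>Coefficients of a trigonometric polynomial close to a wave\<close>

text \<open>
  The sum is compared with the integral of \<open>h / (1 + (h * x)^2)\<close>: each term is at most the increment
  of \<open>arctan\<close> over the preceding step, by the mean value theorem.
\<close>
lemma sum_inverse_quadratic_nat:
  assumes "h > 0"
  shows "(\<Sum>k=1..N. h / (1 + (h * real k)^2)) \<le> arctan (h * real N)"
proof (induction N)
  case (Suc N)
  have "h * (1 / (1 + (h * real (Suc N))^2)) \<le> arctan (h * real (Suc N)) - arctan (h * real N)"
  proof -
    have "\<exists>z. h * real N < z \<and> z < h * real (Suc N) \<and>
        arctan (h * real (Suc N)) - arctan (h * real N)
          = (h * real (Suc N) - h * real N) * inverse (1 + z^2)"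
      using assms by (intro MVT2) (auto intro: DERIV_arctan)
    then obtain z where z: "h * real N < z" "z < h * real (Suc N)"
      "arctan (h * real (Suc N)) - arctan (h * real N) = h * (1 / (1 + z^2))"
      by (auto simp: algebra_simps divide_inverse)
    have "0 \<le> h * real N" using assms by simp
    then have "z^2 \<le> (h * real (Suc N))^2" using z by (intro power_mono) linarith+
    then have "1 / (1 + (h * real (Suc N))^2) \<le> 1 / (1 + z^2)"
      by (intro divide_left_mono mult_pos_pos) (auto simp: add_pos_nonneg)
    then show ?thesis unfolding z(3) using assms by (intro mult_left_mono) auto
  qed
  then show ?case using Suc by simp
qed simp

text \<open>
  The constant 4 is twice a bound for \<open>arctan\<close>. What matters is the growth \<open>1 / h\<close>, uniformly in the
  finite set of integers.
\<close>
lemma sum_inverse_quadratic_int: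
  fixes T :: "int set" and h :: real
  assumes "h > 0" "finite T"
  shows "(\<Sum>k\<in>T. 1 / (1 + (h * of_int k)^2)) \<le> 1 + 4 / h"
proof -
  define g where "g = (\<lambda>k::int. 1 / (1 + (h * real_of_int k)^2))"
  have g0: "g k \<ge> 0" for k by (simp add: g_def add_nonneg_nonneg)
  define N where "N = (\<Sum>k\<in>T. nat \<bar>k\<bar>)"
  have "T \<subseteq> {- int N..int N}"
  proof
    fix k assume "k \<in> T"
    then have "nat \<bar>k\<bar> \<le> N" unfolding N_def using assms by (intro member_le_sum) auto
    then show "k \<in> {- int N..int N}" by auto
  qed
  then have "(\<Sum>k\<in>T. g k) \<le> (\<Sum>k\<in>{- int N..int N}. g k)"
    using g0 by (intro sum_mono2) auto
  also have "{- int N..int N} = insert 0 ((\<lambda>k. int k) ` {1..N} \<union> (\<lambda>k. - int k) ` {1..N})"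
  proof -
    have "x \<in> insert 0 ((\<lambda>k. int k) ` {1..N} \<union> (\<lambda>k. - int k) ` {1..N})" if "x \<in> {- int N..int N}" for x
    proof (cases "x = 0")
      case False
      then have "x = int (nat \<bar>x\<bar>) \<or> x = - int (nat \<bar>x\<bar>)" "nat \<bar>x\<bar> \<in> {1..N}" using that by auto
      then show ?thesis by blast
    qed simp
    then show ?thesis by (intro equalityI subsetI) (blast, auto)
  qed
  also have "(\<Sum>k\<in>\<dots>. g k) = g 0 + ((\<Sum>k=1..N. g (int k)) + (\<Sum>k=1..N. g (- int k)))"
    by (subst sum.insert, simp, force, subst sum.union_disjoint)
       (force simp: sum.reindex inj_on_def)+
  also have "\<dots> = 1 + 2 * (\<Sum>k=1..N. 1 / (1 + (h * real k)^2))"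
    by (simp add: g_def)
  also have "(\<Sum>k=1..N. 1 / (1 + (h * real k)^2)) \<le> 2 / h"
  proof -
    have "h * (\<Sum>k=1..N. 1 / (1 + (h * real k)^2)) \<le> arctan (h * real N)"
      using sum_inverse_quadratic_nat[OF assms(1), of N] by (simp add: sum_distrib_left)
    also have "\<dots> \<le> 2" using arctan_ubound[of "h * real N"] pi_half_less_two by linarith
    finally show ?thesis using assms(1) by (simp add: field_simps)
  qed
  finally show ?thesis by (simp add: g_def)
qed

lemma bump_integral:
  fixes h :: real
  assumes "h > 0"
  shows "((\<lambda>\<xi>. \<xi> * (h - \<xi>)) has_integral h^3 / 6) {0..h}"
proof -
  have "((\<lambda>\<xi>. \<xi> * (h - \<xi>)) has_integral ((\<lambda>\<xi>. h * \<xi>^2 / 2 - \<xi>^3 / 3) h - (\<lambda>\<xi>. h * \<xi>^2 / 2 - \<xi>^3 / 3) 0)) {0..h}"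
    using assms
    by (intro fundamental_theorem_of_calculus)
       (auto intro!: derivative_eq_intros simp: has_real_derivative_iff_has_vector_derivative[symmetric]
         power2_eq_square algebra_simps)
  also have "(\<lambda>\<xi>. h * \<xi>^2 / 2 - \<xi>^3 / 3) h - (\<lambda>\<xi>. h * \<xi>^2 / 2 - \<xi>^3 / 3) 0 = h^3 / 6"
    by (simp add: power2_eq_square power3_eq_cube)
  finally show ?thesis .
qed

text \<open>
  The bump \<open>\<xi> * (h - \<xi>)\<close> vanishes at both ends of the window, so that its transform decays
  quadratically in the frequency: the first integration by parts leaves no boundary term.
  For frequencies below \<open>1 / h\<close> the total mass \<open>h^3 / 6\<close> is the better bound. The right-hand side
  covers both ranges and is summable over the integers.
\<close>
lemma bump_fourier_bound:
  fixes h :: real and k :: int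
  assumes "h > 0"
  shows "norm (integral {0..h} (\<lambda>\<xi>. of_real (\<xi> * (h - \<xi>)) * exp (\<i> * of_int k * of_real \<xi>)))
    \<le> 12 * h^3 / (1 + (h * of_int k)^2)"
    (is "norm ?W \<le> _")
proof -
  have int: "(\<lambda>\<xi>. of_real (\<xi> * (h - \<xi>)) * exp (\<i> * of_int k * of_real \<xi>)) integrable_on {0..h}"
    by (intro integrable_continuous_real continuous_intros)
  have triv: "norm ?W \<le> h^3 / 6"
  proof -
    have "norm ?W \<le> integral {0..h} (\<lambda>\<xi>. \<xi> * (h - \<xi>))"
      using int bump_integral[OF assms]
      by (intro integral_norm_bound_integral)
         (auto simp: norm_mult simp flip: of_real_diff)
    then show ?thesis using integral_unique[OF bump_integral[OF assms]] by simp
  qed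
  show ?thesis
  proof (cases "\<bar>h * of_int k\<bar> \<le> 1")
    case True
    then have "(h * of_int k)^2 \<le> 1" by (simp add: abs_square_le_1)
    then have "h^3 / 6 * (1 + (h * of_int k)^2) \<le> h^3 / 6 * 2"
      using assms by (intro mult_left_mono) auto
    also have "\<dots> \<le> 12 * h^3" using assms by simp
    finally have "h^3 / 6 \<le> 12 * h^3 / (1 + (h * of_int k)^2)"
      by (subst le_divide_eq) (auto simp: add_pos_nonneg)
    then show ?thesis using triv by linarith
  next
    case False
    then have k0: "k \<noteq> 0" by auto
    define r where "r = \<bar>real_of_int k\<bar>"
    have r: "r > 0" "h * r > 1" "r^2 = (of_int k)^2" using k0 False assms by (auto simp: r_def abs_mult)
    define \<kappa> where "\<kappa> = \<i> * complex_of_int k"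
    have nk: "norm \<kappa> = r" by (simp add: \<kappa>_def norm_mult r_def)
    have \<kappa>0: "\<kappa> \<noteq> 0" using k0 by (simp add: \<kappa>_def)
    \<comment> \<open>Repeated integration by parts of a quadratic against an exponential.\<close>
    define F where "F = (\<lambda>z. exp (\<kappa> * z) * (z * (of_real h - z) / \<kappa> - (of_real h - 2 * z) / \<kappa>^2 - 2 / \<kappa>^3))"
    have F': "(F has_field_derivative z * (of_real h - z) * exp (\<kappa> * z)) (at z)" for z
      unfolding F_def using \<kappa>0
      by (auto intro!: derivative_eq_intros simp: field_simps power2_eq_square power3_eq_cube)
    have "((\<lambda>\<xi>. of_real (\<xi> * (h - \<xi>)) * exp (\<i> * of_int k * of_real \<xi>)) has_integral
        (F (of_real h) - F (of_real 0))) {0..h}"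
      using has_vector_derivative_real_field[OF F'] assms
      by (intro fundamental_theorem_of_calculus[of 0 h "\<lambda>\<xi>. F (of_real \<xi>)"]) (auto simp: \<kappa>_def)
    then have "?W = F (of_real h) - F (of_real 0)" by (rule integral_unique)
    also have "norm \<dots> \<le> (h / r^2 + 2 / r^3) + (h / r^2 + 2 / r^3)"
    proof -
      have e: "norm (exp (\<kappa> * of_real h)) = 1" by (simp add: \<kappa>_def)
      have "norm (F (of_real h)) = norm (of_real h / \<kappa>^2 - 2 / \<kappa>^3)"
        unfolding F_def norm_mult e by simp
      also have "\<dots> \<le> h / r^2 + 2 / r^3"
        using norm_triangle_ineq4[of "of_real h / \<kappa>^2" "2 / \<kappa>^3"] assms
        by (simp add: norm_divide norm_power nk)
      finally have 1: "norm (F (of_real h)) \<le> h / r^2 + 2 / r^3" .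
      have "norm (F (of_real 0)) = norm (- (of_real h / \<kappa>^2) - 2 / \<kappa>^3)"
        unfolding F_def by simp
      also have "\<dots> \<le> h / r^2 + 2 / r^3"
        using norm_triangle_ineq4[of "- (of_real h / \<kappa>^2)" "2 / \<kappa>^3"] assms
        by (simp add: norm_divide norm_power nk)
      finally show ?thesis using 1 norm_triangle_ineq4[of "F (of_real h)" "F (of_real 0)"] by simp
    qed
    also have "\<dots> \<le> 6 * h / r^2"
    proof -
      have "2 / r^3 = 2 * (1 / r^2) * (1 / r)" using r by (simp add: power2_eq_square power3_eq_cube)
      also have "\<dots> \<le> 2 * (1 / r^2) * h"
        using r by (intro mult_left_mono) (auto simp: field_simps)
      finally show ?thesis by simp
    qed
    also have "\<dots> \<le> 12 * h^3 / (1 + (h * of_int k)^2)"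
    proof -
      have "(h * r)^2 \<ge> 1" using r by (simp add: one_le_power)
      then have *: "1 + h^2 * r^2 \<le> 2 * h^2 * r^2" by (simp add: power_mult_distrib)
      have "6 * h * (1 + h^2 * r^2) \<le> 6 * h * (2 * h^2 * r^2)"
        using * assms by (intro mult_left_mono) auto
      also have "\<dots> = 12 * h^3 * r^2" by (simp add: power2_eq_square power3_eq_cube)
      finally have "6 * h * (1 + h^2 * r^2) \<le> 12 * h^3 * r^2" .
      moreover have "r^2 > 0" "1 + h^2 * r^2 > 0" using r by (auto intro!: add_pos_nonneg)
      ultimately have "6 * h / r^2 \<le> 12 * h^3 / (1 + h^2 * r^2)"
        by (simp only: pos_divide_le_eq times_divide_eq_left pos_le_divide_eq)
      then show ?thesis by (simp only: power_mult_distrib r(3))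
    qed
    finally show ?thesis .
  qed
qed

text \<open>
  A trigonometric polynomial that is close to a single wave \<open>B * exp (\<i> * y * t)\<close> on a window of
  length \<open>h\<close> has a coefficient of size at least a multiple of \<open>norm B * h\<close>. The reason is duality: the
  integral of the polynomial against the bump, demodulated by the wave, has size about
  \<open>norm B * h^3\<close>, while the transforms of the bump at all frequencies sum to at most a multiple of
  \<open>h^2\<close>, so the coefficients multiplying them cannot all be small.
\<close>
lemma coefficient_lower_bound:
  fixes c :: "int \<Rightarrow> complex" and B :: complex and M \<xi>\<^sub>0 h :: real and y :: int
  assumes "finite (supp c)" and M: "\<And>x. norm (c x) \<le> M"
    and h: "0 < h" "h \<le> 1"
    and near: "\<And>\<xi>. \<xi> \<in> {0..h} \<Longrightarrow>
      norm (fourier c (\<xi>\<^sub>0 + \<xi>) - B * exp (\<i> * of_int y * of_real \<xi>)) \<le> norm B / 2"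
  shows "norm B * h / 720 \<le> M"
proof -
  define w where "w = (\<lambda>\<xi>::real. \<xi> * (h - \<xi>))"
  define W where "W = (\<lambda>k::int. integral {0..h} (\<lambda>\<xi>. of_real (w \<xi>) * exp (\<i> * of_int k * of_real \<xi>)))"
  have W: "norm (W k) \<le> 12 * h^3 / (1 + (h * of_int k)^2)" for k
    unfolding W_def w_def by (rule bump_fourier_bound[OF h(1)])
  have intW: "((\<lambda>\<xi>. of_real (w \<xi>) * exp (\<i> * of_int k * of_real \<xi>)) has_integral W k) {0..h}" for k
    unfolding W_def w_def by (intro integrable_integral integrable_continuous_real continuous_intros)
  define E where "E = (\<lambda>\<xi>::real. exp (- (\<i> * of_int y * of_real \<xi>)))"
  have E: "norm (E \<xi>) = 1" "exp (\<i> * of_int y * of_real \<xi>) * E \<xi> = 1" for \<xi>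
    by (simp_all add: E_def exp_add[symmetric])
  define f where "f = (\<lambda>\<xi>. of_real (w \<xi>) * (fourier c (\<xi>\<^sub>0 + \<xi>) * E \<xi>))"
  define I where "I = (\<Sum>x\<in>supp c. c x * exp (\<i> * of_int x * of_real \<xi>\<^sub>0) * W (x - y))"
  have fI: "(f has_integral I) {0..h}"
  proof -
    have f_eq: "f = (\<lambda>\<xi>. \<Sum>x\<in>supp c. c x * exp (\<i> * of_int x * of_real \<xi>\<^sub>0) *
        (of_real (w \<xi>) * exp (\<i> * of_int (x - y) * of_real \<xi>)))"
    proof
      fix \<xi>
      have shift: "exp (\<i> * of_int x * of_real (\<xi>\<^sub>0 + \<xi>)) * E \<xi> =
          exp (\<i> * of_int x * of_real \<xi>\<^sub>0) * exp (\<i> * of_int (x - y) * of_real \<xi>)" for x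
        by (simp add: E_def exp_add[symmetric] algebra_simps)
      show "f \<xi> = (\<Sum>x\<in>supp c. c x * exp (\<i> * of_int x * of_real \<xi>\<^sub>0) *
        (of_real (w \<xi>) * exp (\<i> * of_int (x - y) * of_real \<xi>)))"
        unfolding f_def fourier_eq_sum[OF assms(1) order_refl] sum_distrib_left sum_distrib_right
      proof (rule sum.cong[OF refl])
        fix x
        have "of_real (w \<xi>) * (c x * exp (\<i> * of_int x * of_real (\<xi>\<^sub>0 + \<xi>)) * E \<xi>) =
            of_real (w \<xi>) * c x * (exp (\<i> * of_int x * of_real (\<xi>\<^sub>0 + \<xi>)) * E \<xi>)"
          by (simp only: mult.assoc)
        also have "\<dots> = c x * exp (\<i> * of_int x * of_real \<xi>\<^sub>0) *
            (of_real (w \<xi>) * exp (\<i> * of_int (x - y) * of_real \<xi>))"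
          unfolding shift by (simp only: mult_ac)
        finally show "of_real (w \<xi>) * (c x * exp (\<i> * of_int x * of_real (\<xi>\<^sub>0 + \<xi>)) * E \<xi>) = \<dots>" .
      qed
    qed
    show ?thesis unfolding I_def f_eq
      by (intro has_integral_sum has_integral_mult_right intW assms(1))
  qed
  have "norm I \<le> (\<Sum>x\<in>supp c. M * (12 * h^3 / (1 + (h * of_int (x - y))^2)))"
    unfolding I_def
  proof (rule sum_norm_le)
    fix x
    have "norm (c x * exp (\<i> * of_int x * of_real \<xi>\<^sub>0) * W (x - y)) = norm (c x) * norm (W (x - y))"
      by (simp add: norm_mult)
    also have "\<dots> \<le> M * (12 * h^3 / (1 + (h * of_int (x - y))^2))"
      using order_trans[OF norm_ge_zero M[of x]] by (intro mult_mono M W) auto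
    finally show "norm (c x * exp (\<i> * of_int x * of_real \<xi>\<^sub>0) * W (x - y)) \<le> \<dots>" .
  qed
  also have "\<dots> = 12 * M * h^3 * (\<Sum>k\<in>(\<lambda>x. x - y) ` supp c. 1 / (1 + (h * of_int k)^2))"
    by (subst sum.reindex) (auto simp: inj_on_def sum_distrib_left mult_ac)
  also have "\<dots> \<le> 12 * M * h^3 * (1 + 4 / h)"
    using h order_trans[OF norm_ge_zero M[of 0]] assms(1)
    by (intro mult_left_mono sum_inverse_quadratic_int) auto
  also have "\<dots> = 12 * M * h^2 * (h + 4)"
    using h by (simp add: field_simps power2_eq_square power3_eq_cube)
  also have "\<dots> \<le> 12 * M * h^2 * 5"
    using h order_trans[OF norm_ge_zero M[of 0]] by (intro mult_left_mono) auto
  finally have upper: "norm I \<le> 60 * M * h^2" by simp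
  have bump: "(w has_integral h^3 / 6) {0..h}"
    unfolding w_def by (rule bump_integral[OF h(1)])
  have "norm (I - of_real (h^3 / 6) * B) \<le> norm B / 2 * (h^3 / 6)"
  proof -
    have "((\<lambda>\<xi>. of_real (w \<xi>) * B) has_integral of_real (h^3 / 6) * B) {0..h}"
      by (intro has_integral_mult_left has_integral_of_real bump)
    then have d: "((\<lambda>\<xi>. f \<xi> - of_real (w \<xi>) * B) has_integral (I - of_real (h^3 / 6) * B)) {0..h}"
      by (intro has_integral_diff fI)
    have b: "((\<lambda>\<xi>. norm B / 2 * w \<xi>) has_integral norm B / 2 * (h^3 / 6)) {0..h}"
      by (intro has_integral_mult_right bump)
    have "norm (f \<xi> - of_real (w \<xi>) * B) \<le> norm B / 2 * w \<xi>" if \<xi>: "\<xi> \<in> {0..h}" for \<xi>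
    proof -
      have w0: "w \<xi> \<ge> 0" using \<xi> by (simp add: w_def)
      have "f \<xi> - of_real (w \<xi>) * B = of_real (w \<xi>) *
          ((fourier c (\<xi>\<^sub>0 + \<xi>) - B * exp (\<i> * of_int y * of_real \<xi>)) * E \<xi>)"
        by (simp add: f_def left_diff_distrib right_diff_distrib mult.assoc E(2)[of \<xi>, simplified mult.assoc])
      then have "norm (f \<xi> - of_real (w \<xi>) * B) =
          w \<xi> * norm (fourier c (\<xi>\<^sub>0 + \<xi>) - B * exp (\<i> * of_int y * of_real \<xi>))"
        using w0 by (simp add: norm_mult E)
      also have "\<dots> \<le> w \<xi> * (norm B / 2)" by (intro mult_left_mono near \<xi> w0)
      finally show ?thesis by (simp add: mult_ac)
    qed
    then have "norm (integral {0..h} (\<lambda>\<xi>. f \<xi> - of_real (w \<xi>) * B)) \<le>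
        integral {0..h} (\<lambda>\<xi>. norm B / 2 * w \<xi>)"
      using d b by (intro integral_norm_bound_integral) blast+
    then show ?thesis
      unfolding integral_unique[OF d] integral_unique[OF b] .
  qed
  have "norm (of_real (h^3 / 6) * B) = h^3 / 6 * norm B"
    unfolding norm_mult norm_of_real using h by simp
  then have "norm I \<ge> h^3 / 12 * norm B"
  proof -
    have "norm B / 2 * (h^3 / 6) = h^3 / 12 * norm B" "h^3 / 6 * norm B = 2 * (h^3 / 12 * norm B)"
      by simp_all
    with \<open>norm (I - _) \<le> _\<close> \<open>norm (of_real (h^3 / 6) * B) = _\<close> show ?thesis
      using norm_triangle_sub[of "of_real (h^3 / 6) * B" I]
        norm_minus_commute[of "of_real (h^3 / 6) * B" I] by linarith
  qed
  then have "h^3 / 12 * norm B \<le> 60 * M * h^2" using upper by linarith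
  then have "h^2 * (norm B * h / 720) \<le> h^2 * M"
    by (simp add: power2_eq_square power3_eq_cube field_simps)
  then show ?thesis using h by simp
qed

section \<open>Van der Corput estimates for complex phases\<close>

text \<open>
  The first derivative test for \<open>G = exp \<Phi>\<close> with complex phase \<open>\<Phi>\<close>, where \<open>P = \<Phi>'\<close>: write \<open>G = G' / P\<close> and
  integrate by parts. The new integrand \<open>G * Q / P^2\<close> is controlled by the single real function
  \<open>p = Re (w * P)\<close>, as \<open>norm P \<ge> \<bar>p\<bar>\<close> and \<open>norm Q\<close> is at most \<open>K\<close> times \<open>p'\<close>; and
  \<open>p' / p^2\<close> integrates exactly.
\<close>
lemma complex_van_der_Corput_first:
  fixes G P Q :: "real \<Rightarrow> complex" and w :: complex
  assumes "a \<le> b"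
    and G': "\<And>x. x \<in> {a..b} \<Longrightarrow> (G has_vector_derivative P x * G x) (at x within {a..b})"
    and P': "\<And>x. x \<in> {a..b} \<Longrightarrow> (P has_vector_derivative Q x) (at x within {a..b})"
    and Q: "continuous_on {a..b} Q"
    and G1: "\<And>x. x \<in> {a..b} \<Longrightarrow> norm (G x) \<le> 1"
    and w: "norm w = 1"
    and QK: "\<And>x. x \<in> {a..b} \<Longrightarrow> norm (Q x) \<le> K * Re (w * Q x)"
    and "K \<ge> 0" and "l > 0"
    and Pl: "(\<forall>x\<in>{a..b}. Re (w * P x) \<ge> l) \<or> (\<forall>x\<in>{a..b}. Re (w * P x) \<le> - l)"
  shows "norm (integral {a..b} G) \<le> (2 + K) / l"
proof -
  define p where "p = (\<lambda>x. Re (w * P x))"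
  have p_abs: "\<bar>p x\<bar> \<ge> l" if "x \<in> {a..b}" for x
    using Pl that \<open>l > 0\<close> by (force simp: p_def)
  have p_le: "\<bar>p x\<bar> \<le> norm (P x)" for x
    using abs_Re_le_cmod[of "w * P x"] w by (simp add: p_def norm_mult)
  have P_l: "norm (P x) \<ge> l" if "x \<in> {a..b}" for x
    using p_abs[OF that] p_le[of x] by linarith
  have P0: "P x \<noteq> 0" if "x \<in> {a..b}" for x
    using P_l[OF that] \<open>l > 0\<close> by auto
  have p0: "p x \<noteq> 0" if "x \<in> {a..b}" for x
    using p_abs[OF that] \<open>l > 0\<close> by auto
  have contG: "continuous_on {a..b} G"
    by (rule continuous_on_vector_derivative) (use G' in auto)
  have contP: "continuous_on {a..b} P"
    by (rule continuous_on_vector_derivative) (use P' in auto)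
  have contp: "continuous_on {a..b} p"
    unfolding p_def by (intro continuous_intros contP)
  have p': "(p has_vector_derivative Re (w * Q x)) (at x within {a..b})" if "x \<in> {a..b}" for x
    unfolding p_def
    by (rule bounded_linear.has_vector_derivative[OF bounded_linear_Re])
       (use P'[OF that] in \<open>auto intro!: derivative_eq_intros\<close>)
  define R where "R = (\<lambda>x. G x * Q x / (P x)^2)"
  define q where "q = (\<lambda>x. Re (w * Q x) / (p x)^2)"
  have contR: "continuous_on {a..b} R"
    unfolding R_def by (intro continuous_intros contG contP Q) (use P0 in auto)
  have main: "((\<lambda>x. G x - R x) has_integral (G b / P b - G a / P a)) {a..b}"
  proof (rule fundamental_theorem_of_calculus[OF \<open>a \<le> b\<close>])
    fix x assume x: "x \<in> {a..b}"
    have inv: "((\<lambda>x. inverse (P x)) has_vector_derivative - (inverse (P x) * Q x * inverse (P x))) (at x within {a..b})"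
      using P'[OF x] P0[OF x] unfolding has_vector_derivative_def
      by (auto intro!: derivative_eq_intros)
    have "((\<lambda>x. G x * inverse (P x)) has_vector_derivative
        G x * - (inverse (P x) * Q x * inverse (P x)) + P x * G x * inverse (P x)) (at x within {a..b})"
      by (rule has_vector_derivative_mult[OF G'[OF x] inv])
    moreover have "G x * - (inverse (P x) * Q x * inverse (P x)) + P x * G x * inverse (P x) = G x - R x"
      using P0[OF x] by (simp add: R_def field_simps power2_eq_square)
    ultimately show "((\<lambda>x. G x / P x) has_vector_derivative G x - R x) (at x within {a..b})"
      by (simp add: divide_inverse)
  qed
  have intR: "R integrable_on {a..b}" and intG: "G integrable_on {a..b}"
    using contR contG by (auto intro: integrable_continuous_real)
  have "integral {a..b} G = (G b / P b - G a / P a) + integral {a..b} R"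
    using integral_unique[OF main] integral_diff[OF intG intR] by (simp add: diff_eq_eq)
  moreover have "norm (G x / P x) \<le> 1 / l" if "x \<in> {a..b}" for x
    unfolding norm_divide by (intro frac_le) (use G1 P_l that \<open>l > 0\<close> in auto)
  then have "norm (G b / P b) \<le> 1 / l" "norm (G a / P a) \<le> 1 / l"
    using \<open>a \<le> b\<close> by auto
  then have "norm (G b / P b - G a / P a) \<le> 2 / l"
    using norm_triangle_ineq4[of "G b / P b" "G a / P a"] by simp
  moreover have "norm (integral {a..b} R) \<le> K / l"
  proof -
    have q: "((\<lambda>x. K * q x) has_integral (- K / p b - - K / p a)) {a..b}"
    proof (rule fundamental_theorem_of_calculus[OF \<open>a \<le> b\<close>])
      fix x assume x: "x \<in> {a..b}"
      have "(p has_field_derivative Re (w * Q x)) (at x within {a..b})"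
        using p'[OF x] by (simp add: has_real_derivative_iff_has_vector_derivative)
      then have "((\<lambda>x. - K / p x) has_field_derivative K * q x) (at x within {a..b})"
        using p0[OF x] by (auto intro!: derivative_eq_intros simp: q_def power2_eq_square)
      then show "((\<lambda>x. - K / p x) has_vector_derivative K * q x) (at x within {a..b})"
        by (simp add: has_real_derivative_iff_has_vector_derivative)
    qed
    have "norm (integral {a..b} R) \<le> integral {a..b} (\<lambda>x. K * q x)"
    proof (rule integral_norm_bound_integral[OF intR])
      show "(\<lambda>x. K * q x) integrable_on {a..b}" using q by blast
      fix x assume x: "x \<in> {a..b}"
      have "norm (R x) = norm (G x) * norm (Q x) / norm (P x)^2"
        by (simp add: R_def norm_mult norm_divide norm_power)
      also have "\<dots> \<le> 1 * (K * Re (w * Q x)) / \<bar>p x\<bar>^2"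
        using G1[OF x] QK[OF x] p_le[of x] p0[OF x] order_trans[OF norm_ge_zero QK[OF x]]
        by (intro frac_le mult_mono power_mono) auto
      also have "\<dots> = K * q x" by (simp add: q_def)
      finally show "norm (R x) \<le> K * q x" .
    qed
    also have "\<dots> = K * (1 / p a - 1 / p b)"
      using integral_unique[OF q] by (simp add: algebra_simps)
    also have "\<dots> \<le> K * (1 / l)"
    proof (rule mult_left_mono[OF _ \<open>K \<ge> 0\<close>])
      have ab: "a \<in> {a..b}" "b \<in> {a..b}" using \<open>a \<le> b\<close> by auto
      from Pl show "1 / p a - 1 / p b \<le> 1 / l"
      proof
        assume "\<forall>x\<in>{a..b}. Re (w * P x) \<ge> l"
        then have "p a \<ge> l" "p b \<ge> l" using ab by (auto simp: p_def)
        then have "1 / p a \<le> 1 / l" "1 / p b \<ge> 0" using \<open>l > 0\<close> by (auto intro: frac_le)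
        then show ?thesis by linarith
      next
        assume "\<forall>x\<in>{a..b}. Re (w * P x) \<le> - l"
        then have "- p a \<ge> l" "- p b \<ge> l" using ab by (force simp: p_def)+
        then have "1 / (- p b) \<le> 1 / l" "1 / (- p a) \<ge> 0"
          using \<open>l > 0\<close> by (intro frac_le divide_nonneg_nonneg; linarith)+
        then show ?thesis unfolding minus_divide_right[symmetric] by linarith
      qed
    qed
    finally show ?thesis by simp
  qed
  ultimately have "norm (integral {a..b} G) \<le> 2 / l + K / l"
    using norm_triangle_ineq[of "G b / P b - G a / P a" "integral {a..b} R"] by simp
  then show ?thesis by (simp add: add_divide_distrib)
qed

text \<open>
  A function whose derivative is at least \<open>l^2\<close> has absolute value below \<open>l\<close> only within distance
  \<open>1 / l\<close> of one point: its zero, or the endpoint nearest to where a zero would be.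
\<close>
lemma small_values_near_point:
  fixes p q :: "real \<Rightarrow> real"
  assumes "s \<le> t"
    and p': "\<And>x. x \<in> {s..t} \<Longrightarrow> (p has_field_derivative q x) (at x within {s..t})"
    and q: "\<And>x. x \<in> {s..t} \<Longrightarrow> q x \<ge> l^2" and "l > 0"
  obtains c where "c \<in> {s..t}"
    "\<And>x. x \<in> {s..t} \<Longrightarrow> x \<ge> c + 1 / l \<Longrightarrow> p x \<ge> l"
    "\<And>x. x \<in> {s..t} \<Longrightarrow> x \<le> c - 1 / l \<Longrightarrow> p x \<le> - l"
proof -
  have growth: "p y - p x \<ge> l^2 * (y - x)" if "x \<in> {s..t}" "y \<in> {s..t}" "x \<le> y" for x y
  proof -
    have "p x - l^2 * x \<le> p y - l^2 * y"
    proof (rule DERIV_nonneg_imp_increasing_open[OF \<open>x \<le> y\<close>])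
      fix z assume z: "x < z" "z < y"
      then have "s < z" "z < t" "z \<in> {s..t}" using that by auto
      then have "(p has_field_derivative q z) (at z)"
        using p'[of z] at_within_Icc_at[of s z t] by simp
      then have "((\<lambda>x. p x - l^2 * x) has_field_derivative q z - l^2) (at z)"
        by (auto intro!: derivative_eq_intros)
      then show "\<exists>d. ((\<lambda>x. p x - l^2 * x) has_field_derivative d) (at z) \<and> 0 \<le> d"
        using q[OF \<open>z \<in> {s..t}\<close>] by force
    next
      have "continuous_on {s..t} p"
        by (rule DERIV_continuous_on) (use p' in auto)
      then show "continuous_on {x..y} (\<lambda>x. p x - l^2 * x)"
        by (intro continuous_intros) (use that in \<open>auto elim: continuous_on_subset\<close>)
    qed
    then show ?thesis by (simp add: algebra_simps)
  qed
  have step: "l^2 * d \<ge> l" if "d \<ge> 1 / l" for d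
    using mult_left_mono[OF that, of "l^2"] \<open>l > 0\<close> by (simp add: power2_eq_square)
  \<comment> \<open>The two implications cover zeros and endpoints at once: at the right end there is nothing to
    the right of \<open>c\<close>, so the sign of \<open>p c\<close> needed for that side is void.\<close>
  have "\<exists>c\<in>{s..t}. (c < t \<longrightarrow> p c \<ge> 0) \<and> (s < c \<longrightarrow> p c \<le> 0)"
  proof -
    consider "p s \<ge> 0" | "p t \<le> 0" | "p s \<le> 0" "p t \<ge> 0" by linarith
    then show ?thesis
    proof cases
      case 1
      then show ?thesis using \<open>s \<le> t\<close> by (intro bexI[of _ s]) auto
    next
      case 2
      then show ?thesis using \<open>s \<le> t\<close> by (intro bexI[of _ t]) auto
    next
      case 3
      have "continuous_on {s..t} p"
        by (rule DERIV_continuous_on) (use p' in auto)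
      then obtain c where "s \<le> c" "c \<le> t" "p c = 0"
        using IVT'[of p s 0 t] 3 \<open>s \<le> t\<close> by auto
      then show ?thesis by (intro bexI[of _ c]) auto
    qed
  qed
  then obtain c where c: "c \<in> {s..t}" "c < t \<longrightarrow> p c \<ge> 0" "s < c \<longrightarrow> p c \<le> 0" by blast
  have l': "1 / l > 0" using \<open>l > 0\<close> by simp
  show thesis
  proof (rule that[OF c(1)])
    fix x assume x: "x \<in> {s..t}" "x \<ge> c + 1 / l"
    then have "c < t" using l' unfolding atLeastAtMost_iff by linarith
    then have "p c \<ge> 0" "c \<le> x" using c(2) x(2) l' by (blast, linarith)
    then show "p x \<ge> l" using growth[OF c(1) x(1)] step[of "x - c"] x(2) by linarith
  next
    fix x assume x: "x \<in> {s..t}" "x \<le> c - 1 / l"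
    then have "s < c" using l' unfolding atLeastAtMost_iff by linarith
    then have "p c \<le> 0" "x \<le> c" using c(3) x(2) l' by (blast, linarith)
    then show "p x \<le> - l" using growth[OF x(1) c(1)] step[of "c - x"] x(2) by linarith
  qed
qed

lemma norm_integral_le_length:
  fixes G :: "real \<Rightarrow> complex"
  assumes "continuous_on {a..b} G" "\<And>x. x \<in> {a..b} \<Longrightarrow> norm (G x) \<le> 1" "a \<le> b"
  shows "norm (integral {a..b} G) \<le> b - a"
  using integral_bound[of a b G 1] assms by simp

text \<open>
  The second derivative test. The interval of length at most \<open>2 / l\<close> on which the rotated phase
  derivative is small is estimated trivially, and the first derivative test applies to either side
  of it. The phase may be complex: besides \<open>norm G \<le> 1\<close>, only one rotation \<open>w\<close> that brings \<open>\<Phi>'' = Q\<close> into a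
  sector around the positive real axis is required. Real decay and oscillation are thus treated
  alike.
\<close>
lemma complex_van_der_Corput:
  fixes G P Q :: "real \<Rightarrow> complex" and w :: complex
  assumes "s \<le> t"
    and G': "\<And>x. x \<in> {s..t} \<Longrightarrow> (G has_vector_derivative P x * G x) (at x within {s..t})"
    and P': "\<And>x. x \<in> {s..t} \<Longrightarrow> (P has_vector_derivative Q x) (at x within {s..t})"
    and Q: "continuous_on {s..t} Q"
    and G1: "\<And>x. x \<in> {s..t} \<Longrightarrow> norm (G x) \<le> 1"
    and w: "norm w = 1"
    and QK: "\<And>x. x \<in> {s..t} \<Longrightarrow> norm (Q x) \<le> K * Re (w * Q x)"
    and "K \<ge> 0" and "l > 0"
    and Ql: "\<And>x. x \<in> {s..t} \<Longrightarrow> Re (w * Q x) \<ge> l^2"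
  shows "norm (integral {s..t} G) \<le> (6 + 2 * K) / l"
proof -
  have contG: "continuous_on {s..t} G"
    by (rule continuous_on_vector_derivative) (use G' in auto)
  have intG: "G integrable_on {a..b}" if "{a..b} \<subseteq> {s..t}" for a b
    using contG that by (intro integrable_continuous_real) (rule continuous_on_subset)
  have p': "((\<lambda>x. Re (w * P x)) has_field_derivative Re (w * Q x)) (at x within {s..t})"
    if "x \<in> {s..t}" for x
    unfolding has_real_derivative_iff_has_vector_derivative
    by (rule bounded_linear.has_vector_derivative[OF bounded_linear_Re])
       (use P'[OF that] in \<open>auto intro!: derivative_eq_intros\<close>)
  obtain c where c: "c \<in> {s..t}"
    "\<And>x. x \<in> {s..t} \<Longrightarrow> x \<ge> c + 1 / l \<Longrightarrow> Re (w * P x) \<ge> l"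
    "\<And>x. x \<in> {s..t} \<Longrightarrow> x \<le> c - 1 / l \<Longrightarrow> Re (w * P x) \<le> - l"
    using small_values_near_point[OF \<open>s \<le> t\<close> p' Ql \<open>l > 0\<close>] by blast
  have l': "1 / l > 0" using \<open>l > 0\<close> by simp
  define a where "a = max s (c - 1 / l)"
  define b where "b = min t (c + 1 / l)"
  have ab: "s \<le> a" "a \<le> c" "c \<le> b" "b \<le> t" "b - a \<le> 2 / l"
    using c(1) l' by (auto simp: a_def b_def)
  have part: "norm (integral {x..y} G) \<le> (2 + K) / l"
    if "s \<le> x" "x \<le> y" "y \<le> t"
       "(\<forall>z\<in>{x..y}. Re (w * P z) \<ge> l) \<or> (\<forall>z\<in>{x..y}. Re (w * P z) \<le> - l)" for x y
  proof (rule complex_van_der_Corput_first[OF \<open>x \<le> y\<close> _ _ _ _ w _ \<open>K \<ge> 0\<close> \<open>l > 0\<close> that(4)])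
    have sub: "{x..y} \<subseteq> {s..t}" using that by auto
    show "continuous_on {x..y} Q" using Q sub by (rule continuous_on_subset)
    fix z assume "z \<in> {x..y}"
    then have z: "z \<in> {s..t}" using sub by auto
    show "(G has_vector_derivative P z * G z) (at z within {x..y})"
      by (rule has_vector_derivative_within_subset[OF G'[OF z] sub])
    show "(P has_vector_derivative Q z) (at z within {x..y})"
      by (rule has_vector_derivative_within_subset[OF P'[OF z] sub])
    show "norm (G z) \<le> 1" "norm (Q z) \<le> K * Re (w * Q z)" using G1[OF z] QK[OF z] .
  qed
  have 1: "norm (integral {s..a} G) \<le> (2 + K) / l"
  proof (cases "s = a")
    case True
    then show ?thesis using \<open>K \<ge> 0\<close> \<open>l > 0\<close> by simp
  next
    case False
    then have "a = c - 1 / l" by (auto simp: a_def)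
    then show ?thesis using ab c by (intro part) auto
  qed
  have 3: "norm (integral {b..t} G) \<le> (2 + K) / l"
  proof (cases "b = t")
    case True
    then show ?thesis using \<open>K \<ge> 0\<close> \<open>l > 0\<close> by simp
  next
    case False
    then have "b = c + 1 / l" by (auto simp: b_def)
    then show ?thesis using ab c by (intro part) auto
  qed
  have 2: "norm (integral {a..b} G) \<le> 2 / l"
    using norm_integral_le_length[of a b G] continuous_on_subset[OF contG, of "{a..b}"] G1 ab
    by force
  have "integral {s..t} G = integral {s..a} G + (integral {a..b} G + integral {b..t} G)"
  proof -
    have "integral {s..a} G + integral {a..t} G = integral {s..t} G"
      by (rule Henstock_Kurzweil_Integration.integral_combine) (use ab intG[of s t] in auto)
    moreover have "integral {a..b} G + integral {b..t} G = integral {a..t} G"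
      by (rule Henstock_Kurzweil_Integration.integral_combine) (use ab intG[of a t] in auto)
    ultimately show ?thesis by simp
  qed
  also have "norm \<dots> \<le> (2 + K) / l + (2 / l + (2 + K) / l)"
    by (intro norm_triangle_mono 1 2 3)
  also have "\<dots> = (6 + 2 * K) / l" using \<open>l > 0\<close> by (simp add: field_simps)
  finally show ?thesis .
qed

text \<open>
  Within distance \<open>d = n powr (- 1 / (k + 2))\<close> of \<open>\<xi>\<^sub>0\<close> the trivial bound suffices. Beyond it, the
  phase has second derivative \<open>n * (\<xi> - \<xi>\<^sub>0)^k * \<kappa> \<xi>\<close>, of size at least a multiple of \<open>n * d^k = 1 / d^2\<close>; the
  second derivative test then yields a multiple of \<open>d\<close> again. The frequency \<open>x\<close> enters only the
  first derivative of the phase, which is why the bound is uniform in \<open>x\<close>.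
\<close>
lemma oscillatory_integral_local_bound:
  fixes f L \<kappa> :: "real \<Rightarrow> complex"
  assumes "r > 0"
    and f': "\<And>\<xi>. \<xi> \<in> {\<xi>\<^sub>0 - r..\<xi>\<^sub>0 + r} \<Longrightarrow> (f has_vector_derivative L \<xi> * f \<xi>) (at \<xi>)"
    and L': "\<And>\<xi>. \<xi> \<in> {\<xi>\<^sub>0 - r..\<xi>\<^sub>0 + r} \<Longrightarrow>
        (L has_vector_derivative of_real ((\<xi> - \<xi>\<^sub>0)^k) * \<kappa> \<xi>) (at \<xi>)"
    and \<kappa>: "continuous_on {\<xi>\<^sub>0 - r..\<xi>\<^sub>0 + r} \<kappa>" and \<kappa>0: "\<kappa> \<xi>\<^sub>0 \<noteq> 0"
    and f1: "\<And>\<xi>. norm (f \<xi>) \<le> 1"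
  obtains \<delta> C where "\<delta> > 0" "C > 0"
    "\<And>n d a b x. n \<ge> (1::nat) \<Longrightarrow> d > 0 \<Longrightarrow> real n * d^(k + 2) = 1 \<Longrightarrow>
      a \<le> \<xi>\<^sub>0 \<Longrightarrow> \<xi>\<^sub>0 \<le> b \<Longrightarrow> b - a < \<delta> \<Longrightarrow>
      norm (integral {a..b} (\<lambda>\<xi>. f \<xi>^n * exp (- (\<i> * of_int x * of_real \<xi>)))) \<le> C * d"
proof -
  \<comment> \<open>The rotation that makes \<open>\<kappa> \<xi>\<^sub>0\<close> positive; by continuity it keeps \<open>\<kappa>\<close> in a sector nearby.\<close>
  define \<omega> where "\<omega> = cnj (\<kappa> \<xi>\<^sub>0) / of_real (norm (\<kappa> \<xi>\<^sub>0))"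
  define c where "c = norm (\<kappa> \<xi>\<^sub>0) / 2"
  have c: "c > 0" using \<kappa>0 by (simp add: c_def)
  have \<omega>: "norm \<omega> = 1" using \<kappa>0 by (simp add: \<omega>_def norm_divide)
  have \<omega>\<kappa>: "\<omega> * \<kappa> \<xi>\<^sub>0 = of_real (2 * c)"
  proof -
    have "cnj (\<kappa> \<xi>\<^sub>0) * \<kappa> \<xi>\<^sub>0 = of_real (norm (\<kappa> \<xi>\<^sub>0))^2"
      by (metis complex_norm_square mult.commute of_real_power)
    then show ?thesis using \<kappa>0 by (simp add: \<omega>_def c_def power2_eq_square)
  qed
  obtain \<delta> where "\<delta> > 0" and \<delta>: "\<And>\<xi>. \<xi> \<in> {\<xi>\<^sub>0 - r..\<xi>\<^sub>0 + r} \<Longrightarrow> \<bar>\<xi> - \<xi>\<^sub>0\<bar> < \<delta> \<Longrightarrow> norm (\<kappa> \<xi> - \<kappa> \<xi>\<^sub>0) < c"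
    using \<kappa>[unfolded continuous_on_iff, rule_format, of \<xi>\<^sub>0 c] c \<open>r > 0\<close>
    by (auto simp: dist_norm)
  define \<epsilon> where "\<epsilon> = min r \<delta>"
  have \<epsilon>: "\<epsilon> > 0" "\<epsilon> \<le> r" "\<epsilon> \<le> \<delta>" using \<open>r > 0\<close> \<open>\<delta> > 0\<close> by (auto simp: \<epsilon>_def)
  have \<kappa>b: "Re (\<omega> * \<kappa> \<xi>) \<ge> c" "norm (\<kappa> \<xi>) \<le> 3 * Re (\<omega> * \<kappa> \<xi>)" if "\<bar>\<xi> - \<xi>\<^sub>0\<bar> < \<epsilon>" for \<xi>
  proof -
    have d: "norm (\<kappa> \<xi> - \<kappa> \<xi>\<^sub>0) < c" by (rule \<delta>) (use that \<epsilon> in auto)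
    have "\<bar>Re (\<omega> * (\<kappa> \<xi> - \<kappa> \<xi>\<^sub>0))\<bar> < c"
      using abs_Re_le_cmod[of "\<omega> * (\<kappa> \<xi> - \<kappa> \<xi>\<^sub>0)"] d by (simp add: norm_mult \<omega>)
    then show 1: "Re (\<omega> * \<kappa> \<xi>) \<ge> c"
      using arg_cong[OF \<omega>\<kappa>, of Re] by (simp add: right_diff_distrib)
    have "norm (\<kappa> \<xi>) \<le> norm (\<kappa> \<xi>\<^sub>0) + c" using d norm_triangle_sub[of "\<kappa> \<xi>" "\<kappa> \<xi>\<^sub>0"] by linarith
    then show "norm (\<kappa> \<xi>) \<le> 3 * Re (\<omega> * \<kappa> \<xi>)" using 1 by (simp add: c_def)
  qed
  define C where "C = 2 * (1 + 12 / sqrt c)"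
  have main: "norm (integral {a..b} (\<lambda>\<xi>. f \<xi>^n * exp (- (\<i> * of_int x * of_real \<xi>)))) \<le> C * d"
    if n: "n \<ge> 1" and d: "d > 0" "real n * d^(k + 2) = 1" and ab: "a \<le> \<xi>\<^sub>0" "\<xi>\<^sub>0 \<le> b" "b - a < \<epsilon>"
    for n :: nat and d a b :: real and x :: int
  proof -
    define G where "G = (\<lambda>\<xi>. f \<xi>^n * exp (- (\<i> * of_int x * of_real \<xi>)))"
    define P where "P = (\<lambda>\<xi>. of_nat n * L \<xi> - \<i> * of_int x)"
    define Q where "Q = (\<lambda>\<xi>. of_nat n * (of_real ((\<xi> - \<xi>\<^sub>0)^k) * \<kappa> \<xi>))"
    have G1: "norm (G \<xi>) \<le> 1" for \<xi>
      unfolding G_def norm_mult norm_power using f1[of \<xi>] by (simp add: power_le_one)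
    have G': "(G has_vector_derivative P \<xi> * G \<xi>) (at \<xi> within S)" if "\<xi> \<in> {\<xi>\<^sub>0 - r..\<xi>\<^sub>0 + r}" for \<xi> S
    proof -
      have fn: "((\<lambda>\<xi>. f \<xi>^n) has_vector_derivative of_nat n * L \<xi> * f \<xi>^n) (at \<xi>)"
      proof -
        have "((\<lambda>z. z^n) has_field_derivative of_nat n * f \<xi>^(n - 1)) (at (f \<xi>))"
          by (auto intro!: derivative_eq_intros)
        from field_vector_diff_chain_at[OF f'[OF that] this]
        have "((\<lambda>\<xi>. f \<xi>^n) has_vector_derivative (L \<xi> * f \<xi>) * (of_nat n * f \<xi>^(n - 1))) (at \<xi>)"
          by (simp add: o_def)
        moreover have "f \<xi>^n = f \<xi> * f \<xi>^(n - 1)" using n by (simp add: power_eq_if)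
        ultimately show ?thesis by (simp add: mult_ac)
      qed
      have "((\<lambda>z. exp (- (\<i> * of_int x * z))) has_field_derivative
          - (\<i> * of_int x) * exp (- (\<i> * of_int x * of_real \<xi>))) (at (of_real \<xi>))"
        by (auto intro!: derivative_eq_intros)
      from has_vector_derivative_mult[OF fn has_vector_derivative_real_field[OF this]]
      have "(G has_vector_derivative P \<xi> * G \<xi>) (at \<xi>)"
        unfolding G_def P_def by (simp add: algebra_simps)
      then show ?thesis by (rule has_vector_derivative_at_within)
    qed
    have P': "(P has_vector_derivative Q \<xi>) (at \<xi> within S)" if "\<xi> \<in> {\<xi>\<^sub>0 - r..\<xi>\<^sub>0 + r}" for \<xi> S
    proof -
      have "(P has_vector_derivative Q \<xi> - 0) (at \<xi>)"
        unfolding P_def Q_def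
        by (intro has_vector_derivative_diff has_vector_derivative_mult_right
              has_vector_derivative_const L'[OF that])
      then show ?thesis by (auto intro: has_vector_derivative_at_within)
    qed
    have contG: "continuous_on {s..t} G" if "{s..t} \<subseteq> {\<xi>\<^sub>0 - r..\<xi>\<^sub>0 + r}" for s t
      by (rule continuous_on_vector_derivative, rule G') (use that in blast)
    define l where "l = sqrt c / d"
    have l: "l > 0" "l^2 = real n * d^k * c"
    proof -
      have "real n * d^k * d^2 = 1" using d(2) by (simp add: power_add power2_eq_square mult_ac)
      then have "real n * d^k = 1 / d^2"
        using d(1) by (subst eq_divide_eq) simp
      then show "l^2 = real n * d^k * c" using c by (simp add: l_def power_divide)
    qed (use c d in \<open>simp add: l_def\<close>)
    \<comment> \<open>To the left of \<open>\<xi>\<^sub>0\<close> the factor \<open>(\<xi> - \<xi>\<^sub>0)^k\<close> is negative for odd \<open>k\<close>; the sign \<open>e\<close> is absorbed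
      in the rotation.\<close>
    have far: "norm (integral {s..t} G) \<le> 12 / sqrt c * d"
      if st: "s \<le> t" and sub: "\<And>\<xi>. \<xi> \<in> {s..t} \<Longrightarrow> \<bar>\<xi> - \<xi>\<^sub>0\<bar> < \<epsilon>"
        and e: "\<bar>e\<bar> = 1" "\<And>\<xi>. \<xi> \<in> {s..t} \<Longrightarrow> e * (\<xi> - \<xi>\<^sub>0)^k = \<bar>\<xi> - \<xi>\<^sub>0\<bar>^k"
        and away: "\<And>\<xi>. \<xi> \<in> {s..t} \<Longrightarrow> d \<le> \<bar>\<xi> - \<xi>\<^sub>0\<bar>"
      for s t e :: real
    proof -
      define w where "w = of_real e * \<omega>"
      have sub': "{s..t} \<subseteq> {\<xi>\<^sub>0 - r..\<xi>\<^sub>0 + r}" using sub \<epsilon> by force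
      have wQ: "Re (w * Q \<xi>) = real n * \<bar>\<xi> - \<xi>\<^sub>0\<bar>^k * Re (\<omega> * \<kappa> \<xi>)" if "\<xi> \<in> {s..t}" for \<xi>
      proof -
        have eq: "w * Q \<xi> = of_real (real n * (e * (\<xi> - \<xi>\<^sub>0)^k)) * (\<omega> * \<kappa> \<xi>)"
          by (simp add: w_def Q_def mult_ac)
        show ?thesis
          unfolding eq e(2)[OF that] scaleR_conv_of_real[symmetric] by (simp only: scaleR_complex.sel)
      qed
      have "norm (integral {s..t} G) \<le> (6 + 2 * 3) / l"
      proof (rule complex_van_der_Corput[of s t G P Q w 3 l])
        show "continuous_on {s..t} Q"
          unfolding Q_def using continuous_on_subset[OF \<kappa> sub'] by (intro continuous_intros)
        show "norm w = 1" using e(1) \<omega> by (simp add: w_def norm_mult)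
        fix \<xi> assume \<xi>: "\<xi> \<in> {s..t}"
        then have \<xi>': "\<xi> \<in> {\<xi>\<^sub>0 - r..\<xi>\<^sub>0 + r}" using sub' by blast
        show "(G has_vector_derivative P \<xi> * G \<xi>) (at \<xi> within {s..t})" by (rule G'[OF \<xi>'])
        show "(P has_vector_derivative Q \<xi>) (at \<xi> within {s..t})" by (rule P'[OF \<xi>'])
        show "norm (G \<xi>) \<le> 1" by (rule G1)
        have "norm (Q \<xi>) = real n * \<bar>\<xi> - \<xi>\<^sub>0\<bar>^k * norm (\<kappa> \<xi>)"
          unfolding Q_def norm_mult norm_of_real by (simp add: power_abs)
        also have "\<dots> \<le> real n * \<bar>\<xi> - \<xi>\<^sub>0\<bar>^k * (3 * Re (\<omega> * \<kappa> \<xi>))"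
          by (intro mult_left_mono \<kappa>b sub \<xi>) auto
        finally show "norm (Q \<xi>) \<le> 3 * Re (w * Q \<xi>)"
          unfolding wQ[OF \<xi>] by (simp only: mult_ac)
        have "d^k \<le> \<bar>\<xi> - \<xi>\<^sub>0\<bar>^k" using away[OF \<xi>] d by (intro power_mono) auto
        have "real n * d^k * c \<le> real n * \<bar>\<xi> - \<xi>\<^sub>0\<bar>^k * Re (\<omega> * \<kappa> \<xi>)"
          using c by (intro mult_mono mult_left_mono \<kappa>b(1) sub \<xi> mult_nonneg_nonneg zero_le_power) (use \<open>d^k \<le> _\<close> in auto)
        then show "l^2 \<le> Re (w * Q \<xi>)" unfolding wQ[OF \<xi>] l .
      qed (use st l in auto)
      then show ?thesis by (simp add: l_def)
    qed
    have near: "norm (integral {s..t} G) \<le> t - s" if "s \<le> t" "{s..t} \<subseteq> {\<xi>\<^sub>0 - r..\<xi>\<^sub>0 + r}" for s t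
      by (rule norm_integral_le_length) (use that contG G1 in auto)
    have sqc: "12 / sqrt c * d \<ge> 0" using c d by simp
    have comb: "integral {s..u} G + integral {u..t} G = integral {s..t} G"
      if "s \<le> u" "u \<le> t" "{s..t} \<subseteq> {\<xi>\<^sub>0 - r..\<xi>\<^sub>0 + r}" for s u t
      by (rule Henstock_Kurzweil_Integration.integral_combine)
         (use that contG in \<open>auto intro: integrable_continuous_real\<close>)
    have right: "norm (integral {\<xi>\<^sub>0..b} G) \<le> d + 12 / sqrt c * d"
    proof (cases "b \<le> \<xi>\<^sub>0 + d")
      case True
      then show ?thesis using near[of \<xi>\<^sub>0 b] ab \<epsilon> sqc by fastforce
    next
      case False
      have "norm (integral {\<xi>\<^sub>0 + d..b} G) \<le> 12 / sqrt c * d"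
        by (rule far[of _ _ 1]) (use False ab d in auto)
      moreover have "norm (integral {\<xi>\<^sub>0..\<xi>\<^sub>0 + d} G) \<le> d"
        using near[of \<xi>\<^sub>0 "\<xi>\<^sub>0 + d"] False ab \<epsilon> d by force
      moreover have "integral {\<xi>\<^sub>0..b} G = integral {\<xi>\<^sub>0..\<xi>\<^sub>0 + d} G + integral {\<xi>\<^sub>0 + d..b} G"
        using False ab \<epsilon> d by (intro comb[symmetric]) auto
      ultimately show ?thesis by (metis norm_triangle_mono)
    qed
    have left: "norm (integral {a..\<xi>\<^sub>0} G) \<le> d + 12 / sqrt c * d"
    proof (cases "\<xi>\<^sub>0 - d \<le> a")
      case True
      then show ?thesis using near[of a \<xi>\<^sub>0] ab \<epsilon> sqc by fastforce
    next
      case False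
      have "norm (integral {a..\<xi>\<^sub>0 - d} G) \<le> 12 / sqrt c * d"
      proof (rule far[of _ _ "(-1)^k"])
        fix \<xi> assume "\<xi> \<in> {a..\<xi>\<^sub>0 - d}"
        then have "\<bar>\<xi> - \<xi>\<^sub>0\<bar> = (-1) * (\<xi> - \<xi>\<^sub>0)" using d by auto
        then show "(-1)^k * (\<xi> - \<xi>\<^sub>0)^k = \<bar>\<xi> - \<xi>\<^sub>0\<bar>^k" by (simp only: power_mult_distrib)
      qed (use False ab d in \<open>auto simp: power_abs\<close>)
      moreover have "norm (integral {\<xi>\<^sub>0 - d..\<xi>\<^sub>0} G) \<le> d"
        using near[of "\<xi>\<^sub>0 - d" \<xi>\<^sub>0] False ab \<epsilon> d by force
      moreover have "integral {a..\<xi>\<^sub>0} G = integral {\<xi>\<^sub>0 - d..\<xi>\<^sub>0} G + integral {a..\<xi>\<^sub>0 - d} G"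
        using False ab \<epsilon> d comb[of a "\<xi>\<^sub>0 - d" \<xi>\<^sub>0] by (auto simp: add.commute)
      ultimately show ?thesis by (metis norm_triangle_mono)
    qed
    have "integral {a..b} G = integral {a..\<xi>\<^sub>0} G + integral {\<xi>\<^sub>0..b} G"
      using ab \<epsilon> by (intro comb[symmetric]) auto
    then have "norm (integral {a..b} G) \<le> (d + 12 / sqrt c * d) + (d + 12 / sqrt c * d)"
      using left right by (metis norm_triangle_mono)
    also have "\<dots> = C * d" by (simp add: C_def algebra_simps)
    finally show ?thesis by (simp add: G_def)
  qed
  have "C > 0" using c by (simp add: C_def add_pos_pos)
  show thesis by (rule that[OF \<epsilon>(1) \<open>C > 0\<close> main])
qed

section \<open>Expansion at a maximum point\<close>

lemma norm_increment_le:
  fixes g g' :: "real \<Rightarrow> complex"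
  assumes "a \<le> b" "\<And>x. x \<in> {a..b} \<Longrightarrow> (g has_vector_derivative g' x) (at x)"
    and "\<And>x. x \<in> {a..b} \<Longrightarrow> norm (g' x) \<le> B"
  shows "norm (g b - g a) \<le> B * (b - a)"
proof -
  have "(g' has_integral (g b - g a)) {a..b}"
    using assms by (intro fundamental_theorem_of_calculus) (auto intro: has_vector_derivative_at_within)
  moreover have "B \<ge> 0" using order_trans[OF norm_ge_zero assms(3)[of a]] \<open>a \<le> b\<close> by simp
  ultimately show ?thesis
    using has_integral_bound_real[of B "{}" g' "g b - g a" a b] assms by simp
qed

text \<open>
  Twice the real part of the logarithmic derivative is the logarithmic derivative of \<open>(norm f)^2\<close>,
  which is stationary at the maximum.
\<close>
lemma Re_log_derivative_at_max:
  fixes f :: "real \<Rightarrow> complex" and \<mu> :: complex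
  assumes f': "(f has_vector_derivative \<mu> * f \<xi>\<^sub>0) (at \<xi>\<^sub>0)"
    and max: "\<And>\<xi>. norm (f \<xi>) \<le> norm (f \<xi>\<^sub>0)" and "f \<xi>\<^sub>0 \<noteq> 0"
  shows "Re \<mu> = 0"
proof -
  define g where "g = (\<lambda>\<xi>. (Re (f \<xi>))^2 + (Im (f \<xi>))^2)"
  have g: "g \<xi> = norm (f \<xi>)^2" for \<xi> by (simp add: g_def cmod_power2)
  have re: "((\<lambda>\<xi>. Re (f \<xi>)) has_field_derivative Re (\<mu> * f \<xi>\<^sub>0)) (at \<xi>\<^sub>0)"
    and im: "((\<lambda>\<xi>. Im (f \<xi>)) has_field_derivative Im (\<mu> * f \<xi>\<^sub>0)) (at \<xi>\<^sub>0)"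
    unfolding has_real_derivative_iff_has_vector_derivative
    using bounded_linear.has_vector_derivative[OF bounded_linear_Re f']
      bounded_linear.has_vector_derivative[OF bounded_linear_Im f'] by auto
  have "(g has_field_derivative 2 * Re \<mu> * norm (f \<xi>\<^sub>0)^2) (at \<xi>\<^sub>0)"
  proof -
    have "(g has_field_derivative
        real 2 * (Re (\<mu> * f \<xi>\<^sub>0) * Re (f \<xi>\<^sub>0) ^ (2 - Suc 0)) +
        real 2 * (Im (\<mu> * f \<xi>\<^sub>0) * Im (f \<xi>\<^sub>0) ^ (2 - Suc 0))) (at \<xi>\<^sub>0)"
      unfolding g_def by (intro DERIV_add DERIV_power re im)
    then show ?thesis
      by (rule DERIV_cong) (unfold cmod_power2, simp add: power2_eq_square algebra_simps)
  qed
  then have "2 * Re \<mu> * norm (f \<xi>\<^sub>0)^2 = 0"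
    by (rule DERIV_local_max[of _ _ _ 1]) (auto simp: g intro!: power_mono max)
  then show ?thesis using \<open>f \<xi>\<^sub>0 \<noteq> 0\<close> by simp
qed

text \<open>
  Integrating \<open>L' = (\<xi> - \<xi>\<^sub>0)^k * \<kappa>\<close> shows that \<open>L\<close> is within a multiple of \<open>t^(k + 1)\<close> of \<open>\<i> * \<alpha>\<close>.
  The derivative of the demodulated function \<open>f * exp (- \<i> * \<alpha> * t)\<close> is \<open>L - \<i> * \<alpha>\<close> times a bounded factor, and a
  second integration raises the order to \<open>k + 2\<close>.
\<close>
lemma local_expansion_at_max:
  fixes f L \<kappa> :: "real \<Rightarrow> complex"
  assumes "r > 0"
    and f': "\<And>\<xi>. \<xi> \<in> {\<xi>\<^sub>0..\<xi>\<^sub>0 + r} \<Longrightarrow> (f has_vector_derivative L \<xi> * f \<xi>) (at \<xi>)"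
    and L': "\<And>\<xi>. \<xi> \<in> {\<xi>\<^sub>0..\<xi>\<^sub>0 + r} \<Longrightarrow>
        (L has_vector_derivative of_real ((\<xi> - \<xi>\<^sub>0)^k) * \<kappa> \<xi>) (at \<xi>)"
    and \<kappa>: "continuous_on {\<xi>\<^sub>0..\<xi>\<^sub>0 + r} \<kappa>"
    and f1: "\<And>\<xi>. norm (f \<xi>) \<le> 1"
    and \<alpha>: "L \<xi>\<^sub>0 = \<i> * of_real \<alpha>"
  obtains B where "B > 0" "\<And>t. t \<in> {0..r} \<Longrightarrow>
    norm (f (\<xi>\<^sub>0 + t) - f \<xi>\<^sub>0 * exp (\<i> * of_real \<alpha> * of_real t)) \<le> B * t^(k + 2)"
proof -
  obtain B where "B > 0" and B: "\<And>\<xi>. \<xi> \<in> {\<xi>\<^sub>0..\<xi>\<^sub>0 + r} \<Longrightarrow> norm (\<kappa> \<xi>) \<le> B"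
    using compact_imp_bounded[OF compact_continuous_image[OF \<kappa> compact_Icc]]
    by (auto simp: bounded_pos)
  have Lb: "norm (L (\<xi>\<^sub>0 + t) - \<i> * of_real \<alpha>) \<le> B * t^(k + 1)" if t: "t \<in> {0..r}" for t
  proof -
    have "norm (L (\<xi>\<^sub>0 + t) - L \<xi>\<^sub>0) \<le> (t^k * B) * (\<xi>\<^sub>0 + t - \<xi>\<^sub>0)"
    proof (rule norm_increment_le)
      fix x assume x: "x \<in> {\<xi>\<^sub>0..\<xi>\<^sub>0 + t}"
      then have x': "x \<in> {\<xi>\<^sub>0..\<xi>\<^sub>0 + r}" using t by auto
      show "(L has_vector_derivative of_real ((x - \<xi>\<^sub>0)^k) * \<kappa> x) (at x)" by (rule L'[OF x'])
      have "(x - \<xi>\<^sub>0)^k \<le> t^k" using x by (intro power_mono) auto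
      then show "norm (of_real ((x - \<xi>\<^sub>0)^k) * \<kappa> x) \<le> t^k * B"
        unfolding norm_mult norm_of_real using x t B[OF x'] by (intro mult_mono) auto
    qed (use t in auto)
    then show ?thesis by (simp add: \<alpha> mult_ac)
  qed
  define g where "g = (\<lambda>\<xi>. f \<xi> * exp (- (\<i> * of_real \<alpha> * of_real (\<xi> - \<xi>\<^sub>0))))"
  have "norm (f (\<xi>\<^sub>0 + t) - f \<xi>\<^sub>0 * exp (\<i> * of_real \<alpha> * of_real t)) \<le> B * t^(k + 2)"
    if t: "t \<in> {0..r}" for t
  proof -
    have "norm (g (\<xi>\<^sub>0 + t) - g \<xi>\<^sub>0) \<le> (B * t^(k + 1)) * (\<xi>\<^sub>0 + t - \<xi>\<^sub>0)"
    proof (rule norm_increment_le)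
      fix x assume x: "x \<in> {\<xi>\<^sub>0..\<xi>\<^sub>0 + t}"
      then have x': "x \<in> {\<xi>\<^sub>0..\<xi>\<^sub>0 + r}" "x - \<xi>\<^sub>0 \<in> {0..r}" using t by auto
      have "((\<lambda>\<xi>. exp (- (\<i> * of_real \<alpha> * of_real (\<xi> - \<xi>\<^sub>0)))) has_vector_derivative
          - (\<i> * of_real \<alpha>) * exp (- (\<i> * of_real \<alpha> * of_real (x - \<xi>\<^sub>0)))) (at x)"
      proof -
        have "((\<lambda>z. exp (- (\<i> * of_real \<alpha> * (z - of_real \<xi>\<^sub>0)))) has_field_derivative
            - (\<i> * of_real \<alpha>) * exp (- (\<i> * of_real \<alpha> * (of_real x - of_real \<xi>\<^sub>0)))) (at (of_real x))"
          by (auto intro!: derivative_eq_intros)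
        from has_vector_derivative_real_field[OF this] show ?thesis by simp
      qed
      from has_vector_derivative_mult[OF f'[OF x'(1)] this]
      show "(g has_vector_derivative (L x - \<i> * of_real \<alpha>) * g x) (at x)"
        unfolding g_def by (simp add: algebra_simps)
      have "norm (L x - \<i> * of_real \<alpha>) \<le> B * (x - \<xi>\<^sub>0)^(k + 1)"
        using Lb[OF x'(2)] by simp
      also have "\<dots> \<le> B * t^(k + 1)"
        using x \<open>B > 0\<close> by (intro mult_left_mono power_mono) auto
      finally have "norm (L x - \<i> * of_real \<alpha>) * norm (g x) \<le> (B * t^(k + 1)) * 1"
        using f1[of x] x t \<open>B > 0\<close> by (intro mult_mono) (auto simp: g_def norm_mult)
      then show "norm ((L x - \<i> * of_real \<alpha>) * g x) \<le> B * t^(k + 1)" by (simp add: norm_mult)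
    qed (use t in auto)
    also have "(B * t^(k + 1)) * (\<xi>\<^sub>0 + t - \<xi>\<^sub>0) = B * t^(k + 2)" by (simp add: power_add)
    finally have "norm ((g (\<xi>\<^sub>0 + t) - g \<xi>\<^sub>0) * exp (\<i> * of_real \<alpha> * of_real t)) \<le> B * t^(k + 2)"
      by (simp add: norm_mult)
    moreover have "(g (\<xi>\<^sub>0 + t) - g \<xi>\<^sub>0) * exp (\<i> * of_real \<alpha> * of_real t) =
        f (\<xi>\<^sub>0 + t) - f \<xi>\<^sub>0 * exp (\<i> * of_real \<alpha> * of_real t)"
      by (simp add: g_def left_diff_distrib mult.assoc exp_add[symmetric])
    ultimately show ?thesis by simp
  qed
  then show thesis using that[OF \<open>B > 0\<close>] by blast
qed

text \<open>
  For numbers in the unit disc, taking \<open>n\<close>-th powers multiplies the error \<open>B * t^m\<close> by at most \<open>n\<close>, so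
  it stays small for \<open>t\<close> up to a small multiple of \<open>d = n powr (- 1 / m)\<close>. Rounding the
  frequency \<open>n * \<alpha>\<close> to an integer costs at most \<open>t\<close> more.
\<close>
lemma power_approximation:
  fixes f :: "real \<Rightarrow> complex" and \<alpha> B r :: real
  assumes "r > 0" "B > 0" and f1: "\<And>\<xi>. norm (f \<xi>) \<le> 1" and f0: "norm (f \<xi>\<^sub>0) = 1"
    and B: "\<And>t. t \<in> {0..r} \<Longrightarrow>
      norm (f (\<xi>\<^sub>0 + t) - f \<xi>\<^sub>0 * exp (\<i> * of_real \<alpha> * of_real t)) \<le> B * t^m"
    and m: "m \<ge> 1"
  obtains \<delta> where "0 < \<delta>" "\<delta> \<le> 1"
    "\<And>n d t. n \<ge> (1::nat) \<Longrightarrow> d > 0 \<Longrightarrow> real n * d^m = 1 \<Longrightarrow> t \<in> {0..\<delta> * d} \<Longrightarrow>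
      norm (f (\<xi>\<^sub>0 + t)^n - f \<xi>\<^sub>0^n * exp (\<i> * of_int \<lfloor>real n * \<alpha>\<rfloor> * of_real t)) \<le> 1 / 2"
proof -
  \<comment> \<open>The two errors, from the power and from rounding the frequency, get \<open>1 / 4\<close> each.\<close>
  define \<delta> where "\<delta> = min (min r (1/4)) (1 / (4 * B))"
  have "B * \<delta> \<le> B * (1 / (4 * B))"
    unfolding \<delta>_def using \<open>B > 0\<close> by (intro mult_left_mono) auto
  then have \<delta>: "0 < \<delta>" "\<delta> \<le> r" "\<delta> \<le> 1/4" "B * \<delta> \<le> 1/4"
    using \<open>r > 0\<close> \<open>B > 0\<close> by (auto simp: \<delta>_def)
  show thesis
  proof (rule that[of \<delta>])
    fix n :: nat and d t :: real
    assume n: "n \<ge> 1" and d: "d > 0" "real n * d^m = 1" and t: "t \<in> {0..\<delta> * d}"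
    have "d^m \<le> 1"
      using d n mult_right_mono[of 1 "real n" "d^m"] by simp
    then have "d \<le> 1" using d(1) m power_le_one_iff[of d m] by auto
    then have "\<delta> * d \<le> \<delta>" using \<delta>(1) by (simp add: mult_left_le)
    then have td: "t \<le> \<delta>" "t \<ge> 0" using t by auto
    have "t^m \<le> (\<delta> * d)^m" using t by (intro power_mono) auto
    also have "\<dots> = \<delta>^m * d^m" by (simp add: power_mult_distrib)
    also have "\<dots> \<le> \<delta> * d^m"
      using power_decreasing[of 1 m \<delta>] m \<delta> d by (intro mult_right_mono) auto
    finally have tm: "t^m \<le> \<delta> * d^m" .
    define e where "e = exp (\<i> * of_real \<alpha> * of_real t)"
    have e1: "norm e = 1" by (simp add: e_def)
    have "norm (f (\<xi>\<^sub>0 + t)^n - (f \<xi>\<^sub>0 * e)^n) \<le> real n * norm (f (\<xi>\<^sub>0 + t) - f \<xi>\<^sub>0 * e)"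
      using f1 by (intro norm_power_diff) (auto simp: norm_mult e1)
    also have "\<dots> \<le> real n * (B * t^m)"
      unfolding e_def using td \<delta> by (intro mult_left_mono B) auto
    also have "\<dots> \<le> real n * (B * (\<delta> * d^m))"
      using \<open>B > 0\<close> tm by (intro mult_left_mono) auto
    also have "\<dots> = B * \<delta> * (real n * d^m)" by simp
    also have "\<dots> \<le> 1 / 4" using \<delta> d by simp
    finally have 1: "norm (f (\<xi>\<^sub>0 + t)^n - (f \<xi>\<^sub>0 * e)^n) \<le> 1 / 4" .
    define y where "y = \<lfloor>real n * \<alpha>\<rfloor>"
    define \<rho> where "\<rho> = (real n * \<alpha> - of_int y) * t"
    have "\<bar>\<rho>\<bar> \<le> 1 * \<delta>"
      unfolding \<rho>_def abs_mult using td by (intro mult_mono) (auto simp: y_def, linarith)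
    have "e^n = exp (\<i> * of_int y * of_real t) * exp (\<i> * of_real \<rho>)"
      unfolding e_def exp_of_nat_mult[symmetric] exp_add[symmetric]
      by (simp add: \<rho>_def algebra_simps)
    then have "(f \<xi>\<^sub>0 * e)^n - f \<xi>\<^sub>0^n * exp (\<i> * of_int y * of_real t) =
        f \<xi>\<^sub>0^n * exp (\<i> * of_int y * of_real t) * (exp (\<i> * of_real \<rho>) - 1)"
      by (simp add: power_mult_distrib algebra_simps)
    then have "norm ((f \<xi>\<^sub>0 * e)^n - f \<xi>\<^sub>0^n * exp (\<i> * of_int y * of_real t)) =
        norm (exp (\<i> * of_real \<rho>) - 1)"
      by (simp add: norm_mult norm_power f0)
    also have "\<dots> \<le> \<bar>\<rho>\<bar>"
      using dist_exp_i_1[of \<rho>] abs_sin_x_le_abs_x[of "\<rho> / 2"] by (simp add: dist_norm)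
    also have "\<dots> \<le> 1 / 4" using \<open>\<bar>\<rho>\<bar> \<le> 1 * \<delta>\<close> \<delta> by simp
    finally have "norm ((f \<xi>\<^sub>0 * e)^n - f \<xi>\<^sub>0^n * exp (\<i> * of_int y * of_real t)) \<le> 1 / 4" .
    with 1 show "norm (f (\<xi>\<^sub>0 + t)^n - f \<xi>\<^sub>0^n * exp (\<i> * of_int \<lfloor>real n * \<alpha>\<rfloor> * of_real t)) \<le> 1 / 2"
      using norm_triangle_ineq[of "f (\<xi>\<^sub>0 + t)^n - (f \<xi>\<^sub>0 * e)^n"
          "(f \<xi>\<^sub>0 * e)^n - f \<xi>\<^sub>0^n * exp (\<i> * of_int y * of_real t)"]
      by (simp add: y_def)
  qed (use \<delta> in auto)
qed

section \<open>Local bounds and their combination\<close>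

lemma times_powr_root_power:
  assumes "n \<ge> (1::nat)" "m \<ge> (1::nat)"
  shows "real n * (real n powr (- 1 / real m))^m = 1"
proof -
  have "(real n powr (- 1 / real m))^m = real n powr (- 1)"
    using assms by (simp add: powr_power)
  then show ?thesis using assms by (simp add: powr_minus)
qed

lemma powr_root_mono:
  assumes "n \<ge> (1::nat)" "1 \<le> (l::nat)" "l \<le> m"
  shows "real n powr (- 1 / real l) \<le> real n powr (- 1 / real m)"
  using assms by (intro powr_mono) (auto simp: frac_le)

text \<open>
  Both estimates at a maximum point carry the same exponent, because both come from the order of
  vanishing of the derivative of the logarithmic derivative there.
\<close>
lemma bounds_at_max_point:
  fixes A \<xi>\<^sub>0 :: real
  assumes adm: "admissible_support \<phi>" and A: "A > 0"
    and max: "\<And>\<xi>. norm (fourier \<phi> \<xi>) \<le> A" and at: "norm (fourier \<phi> \<xi>\<^sub>0) = A"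
  obtains m c \<delta> C where "m \<ge> (2::nat)" "c > 0" "\<delta> > 0" "C > 0"
    "\<And>n. n \<ge> (1::nat) \<Longrightarrow> c * real n powr (- 1 / real m) \<le> sup_norm (conv_power \<phi> n) / A^n"
    "\<And>n a b x. n \<ge> (1::nat) \<Longrightarrow> a \<le> \<xi>\<^sub>0 \<Longrightarrow> \<xi>\<^sub>0 \<le> b \<Longrightarrow> b - a < \<delta> \<Longrightarrow>
      norm (integral {a..b} (\<lambda>\<xi>. (fourier \<phi> \<xi> / of_real A)^n * exp (- (\<i> * of_int x * of_real \<xi>))))
        \<le> C * real n powr (- 1 / real m)"
proof -
  have fin: "finite (supp \<phi>)" using adm by (simp add: admissible_support_def)
  define u where "u = (\<lambda>\<xi>. fourier \<phi> \<xi> / of_real A)"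
  have f0: "fourier \<phi> \<xi>\<^sub>0 \<noteq> 0" using at A by auto
  have u1: "norm (u \<xi>) \<le> 1" for \<xi> using max[of \<xi>] A by (simp add: u_def norm_divide)
  have u0: "norm (u \<xi>\<^sub>0) = 1" using at A by (simp add: u_def norm_divide)
  obtain r k L \<kappa> where r: "r > 0"
    and f': "\<And>\<xi>. \<xi> \<in> {\<xi>\<^sub>0 - r..\<xi>\<^sub>0 + r} \<Longrightarrow>
      (fourier \<phi> has_vector_derivative L \<xi> * fourier \<phi> \<xi>) (at \<xi>)"
    and L': "\<And>\<xi>. \<xi> \<in> {\<xi>\<^sub>0 - r..\<xi>\<^sub>0 + r} \<Longrightarrow>
      (L has_vector_derivative of_real ((\<xi> - \<xi>\<^sub>0)^k) * \<kappa> \<xi>) (at \<xi>)"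
    and \<kappa>: "continuous_on {\<xi>\<^sub>0 - r..\<xi>\<^sub>0 + r} \<kappa>" "\<kappa> \<xi>\<^sub>0 \<noteq> 0"
    by (rule log_derivative_factorization[OF adm f0]) blast
  have u': "(u has_vector_derivative L \<xi> * u \<xi>) (at \<xi>)" if "\<xi> \<in> {\<xi>\<^sub>0 - r..\<xi>\<^sub>0 + r}" for \<xi>
    using has_vector_derivative_mult_right[OF f'[OF that], of "1 / of_real A"]
    by (simp add: u_def)
  define m where "m = k + 2"
  have m: "m \<ge> 1" "m \<ge> 2" by (auto simp: m_def)
  have "Re (L \<xi>\<^sub>0) = 0"
    by (rule Re_log_derivative_at_max[of u _ \<xi>\<^sub>0]) (use u' u1 u0 r in auto)
  then obtain \<alpha> where \<alpha>: "L \<xi>\<^sub>0 = \<i> * of_real \<alpha>"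
    by (metis complex_eq mult_zero_left add_0 of_real_0)
  obtain B where B: "B > 0" "\<And>t. t \<in> {0..r} \<Longrightarrow>
      norm (u (\<xi>\<^sub>0 + t) - u \<xi>\<^sub>0 * exp (\<i> * of_real \<alpha> * of_real t)) \<le> B * t^(k + 2)"
    by (rule local_expansion_at_max[of r \<xi>\<^sub>0 u L k \<kappa> \<alpha>])
       (use r u' L' u1 \<alpha> in \<open>auto intro: continuous_on_subset[OF \<kappa>(1)]\<close>)
  obtain \<eta> where \<eta>: "0 < \<eta>" "\<eta> \<le> 1"
    "\<And>n d t. n \<ge> (1::nat) \<Longrightarrow> d > 0 \<Longrightarrow> real n * d^m = 1 \<Longrightarrow> t \<in> {0..\<eta> * d} \<Longrightarrow>
      norm (u (\<xi>\<^sub>0 + t)^n - u \<xi>\<^sub>0^n * exp (\<i> * of_int \<lfloor>real n * \<alpha>\<rfloor> * of_real t)) \<le> 1 / 2"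
    by (rule power_approximation[OF r B(1) u1 u0 B(2)[folded m_def] m(1)]) blast+
  obtain \<delta> C where \<delta>C: "\<delta> > 0" "C > 0"
    "\<And>n d a b x. n \<ge> (1::nat) \<Longrightarrow> d > 0 \<Longrightarrow> real n * d^m = 1 \<Longrightarrow>
      a \<le> \<xi>\<^sub>0 \<Longrightarrow> \<xi>\<^sub>0 \<le> b \<Longrightarrow> b - a < \<delta> \<Longrightarrow>
      norm (integral {a..b} (\<lambda>\<xi>. u \<xi>^n * exp (- (\<i> * of_int x * of_real \<xi>)))) \<le> C * d"
    unfolding m_def by (rule oscillatory_integral_local_bound[OF r u' L' \<kappa> u1]) blast+
  show thesis
  proof (rule that[OF m(2) _ \<delta>C(1,2)])
    show "\<eta> / 720 > 0" using \<eta> by simp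
  next
    fix n :: nat assume n: "n \<ge> 1"
    define d where "d = real n powr (- 1 / real m)"
    have d: "d > 0" "real n * d^m = 1"
      using n times_powr_root_power[OF n m(1)] by (auto simp: d_def)
    have "d \<le> 1" unfolding d_def using n ge_one_powr_ge_zero[of "real n" "1 / real m"] by (simp add: powr_minus inverse_le_1_iff)
    have "norm (fourier \<phi> \<xi>\<^sub>0^n) * (\<eta> * d) / 720 \<le> sup_norm (conv_power \<phi> n)"
    proof (rule coefficient_lower_bound[of "conv_power \<phi> n" _ "\<eta> * d" \<xi>\<^sub>0 _ "\<lfloor>real n * \<alpha>\<rfloor>"])
      show "finite (supp (conv_power \<phi> n))" by (rule finite_supp_conv_power[OF fin])
      then show "norm (conv_power \<phi> n x) \<le> sup_norm (conv_power \<phi> n)" for x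
        by (rule norm_le_sup_norm)
      show "0 < \<eta> * d" using \<eta> d by simp
      show "\<eta> * d \<le> 1" using \<eta> \<open>d \<le> 1\<close> d by (simp add: mult_le_one)
      fix t assume t: "t \<in> {0..\<eta> * d}"
      have "fourier (conv_power \<phi> n) (\<xi>\<^sub>0 + t) -
          fourier \<phi> \<xi>\<^sub>0^n * exp (\<i> * of_int \<lfloor>real n * \<alpha>\<rfloor> * of_real t) =
          of_real (A^n) * (u (\<xi>\<^sub>0 + t)^n - u \<xi>\<^sub>0^n * exp (\<i> * of_int \<lfloor>real n * \<alpha>\<rfloor> * of_real t))"
        using A by (simp add: fourier_conv_power[OF fin] u_def power_divide right_diff_distrib)
      also have "norm \<dots> \<le> A^n * (1 / 2)"
        unfolding norm_mult norm_of_real using A \<eta>(3)[OF n d t] by (intro mult_mono) auto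
      finally show "norm (fourier (conv_power \<phi> n) (\<xi>\<^sub>0 + t) -
          fourier \<phi> \<xi>\<^sub>0^n * exp (\<i> * of_int \<lfloor>real n * \<alpha>\<rfloor> * of_real t)) \<le> norm (fourier \<phi> \<xi>\<^sub>0^n) / 2"
        by (simp add: norm_power at)
    qed
    then show "\<eta> / 720 * real n powr (- 1 / real m) \<le> sup_norm (conv_power \<phi> n) / A^n"
      unfolding d_def[symmetric] using A by (simp add: norm_power at pos_le_divide_eq mult_ac)
    fix a b :: real and x :: int
    assume "a \<le> \<xi>\<^sub>0" "\<xi>\<^sub>0 \<le> b" "b - a < \<delta>"
    from \<delta>C(3)[OF n d this]
    show "norm (integral {a..b} (\<lambda>\<xi>. (fourier \<phi> \<xi> / of_real A)^n * exp (- (\<i> * of_int x * of_real \<xi>))))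
        \<le> C * real n powr (- 1 / real m)"
      unfolding u_def d_def .
  qed
qed

text \<open>
  Here the integrand is exponentially small. The comparison with a power of \<open>n\<close> is made so that this
  contribution can be absorbed in that of a maximum point, whatever its exponent.
\<close>
lemma bound_away_from_max:
  fixes u :: "real \<Rightarrow> complex"
  assumes cont: "continuous_on UNIV u" and u: "norm (u \<xi>\<^sub>0) < 1" and m: "m \<ge> (2::nat)"
  obtains \<delta> C where "\<delta> > 0" "C > 0"
    "\<And>n a b x. n \<ge> (1::nat) \<Longrightarrow> a \<le> \<xi>\<^sub>0 \<Longrightarrow> \<xi>\<^sub>0 \<le> b \<Longrightarrow> b - a < \<delta> \<Longrightarrow>
      norm (integral {a..b} (\<lambda>\<xi>. u \<xi>^n * exp (- (\<i> * of_int x * of_real \<xi>))))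
        \<le> C * real n powr (- 1 / real m)"
proof -
  obtain \<rho> where \<rho>: "norm (u \<xi>\<^sub>0) < \<rho>" "\<rho> < 1" using dense[OF u] by blast
  then have \<rho>0: "\<rho> > 0" using norm_ge_zero[of "u \<xi>\<^sub>0"] by linarith
  obtain \<delta> where \<delta>: "\<delta> > 0" "\<And>\<xi>. \<bar>\<xi> - \<xi>\<^sub>0\<bar> < \<delta> \<Longrightarrow> norm (u \<xi>) < \<rho>"
  proof -
    have "\<exists>d>0. \<forall>\<xi>\<in>UNIV. dist \<xi> \<xi>\<^sub>0 < d \<longrightarrow> dist (u \<xi>) (u \<xi>\<^sub>0) < \<rho> - norm (u \<xi>\<^sub>0)"
      using cont[unfolded continuous_on_iff] \<rho> by simp
    then obtain d where d: "d > 0" "\<And>\<xi>. \<bar>\<xi> - \<xi>\<^sub>0\<bar> < d \<Longrightarrow> norm (u \<xi> - u \<xi>\<^sub>0) < \<rho> - norm (u \<xi>\<^sub>0)"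
      by (auto simp: dist_norm)
    show thesis
    proof (rule that[OF d(1)])
      fix \<xi> assume "\<bar>\<xi> - \<xi>\<^sub>0\<bar> < d"
      then show "norm (u \<xi>) < \<rho>"
        using d(2)[of \<xi>] norm_triangle_sub[of "u \<xi>" "u \<xi>\<^sub>0"] by linarith
    qed
  qed
  have "Bseq (\<lambda>n. of_nat n * \<rho>^n :: real)"
    using \<rho> \<rho>0 by (intro convergent_imp_Bseq convergentI[OF powser_times_n_limit_0]) auto
  then obtain K where K: "K > 0" "\<And>n. norm (real n * \<rho>^n) \<le> K" by (auto elim: BseqE)
  show thesis
  proof (rule that[OF \<delta>(1), of "K * \<delta>"])
    show "K * \<delta> > 0" using K \<delta> by simp
    fix n :: nat and a b :: real and x :: int
    assume n: "n \<ge> 1" and ab: "a \<le> \<xi>\<^sub>0" "\<xi>\<^sub>0 \<le> b" "b - a < \<delta>"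
    define G where "G = (\<lambda>\<xi>. u \<xi>^n * exp (- (\<i> * of_int x * of_real \<xi>)))"
    have "norm (integral {a..b} G) \<le> \<rho>^n * (b - a)"
    proof (rule integral_bound)
      show "continuous_on {a..b} G"
        unfolding G_def by (intro continuous_intros continuous_on_subset[OF cont]) auto
      fix \<xi> assume "\<xi> \<in> {a..b}"
      then have "norm (u \<xi>) < \<rho>" using \<delta>(2)[of \<xi>] ab by auto
      then show "norm (G \<xi>) \<le> \<rho>^n"
        by (simp add: G_def norm_mult norm_power power_mono)
    qed (use ab in auto)
    also have "\<dots> \<le> \<rho>^n * \<delta>" using ab \<rho>0 by (intro mult_left_mono) auto
    also have "\<rho>^n \<le> K / real n" using K(2)[of n] n \<rho>0 by (simp add: field_simps)
    also have "K / real n = K * real n powr (- 1 / real 1)" using n by (simp add: powr_minus divide_inverse)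
    also have "\<dots> \<le> K * real n powr (- 1 / real m)"
      using K n m by (intro mult_left_mono powr_root_mono) auto
    finally show "norm (integral {a..b} G) \<le> K * \<delta> * real n powr (- 1 / real m)"
      using \<delta>(1) by (simp add: mult_ac)
  qed
qed

theorem theorem1p1:
  fixes \<phi> :: "int \<Rightarrow> complex" and A :: real
  assumes "admissible_support \<phi>"
    and "A = (SUP \<xi>. norm (fourier \<phi> \<xi>))"
  shows "\<exists>m::nat. m \<ge> 2 \<and>
    (\<exists>C C'::real. C > 0 \<and> C' > 0 \<and>
      (\<forall>n::nat. n \<ge> 1 \<longrightarrow>
        C * real n powr (- 1 / real m) \<le> A powi (- int n) * sup_norm (conv_power \<phi> n) \<and>
        A powi (- int n) * sup_norm (conv_power \<phi> n) \<le> C' * real n powr (- 1 / real m)))"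
proof -
  have fin: "finite (supp \<phi>)" and card: "card (supp \<phi>) > 1"
    using assms(1) by (auto simp: admissible_support_def)
  obtain \<xi>\<^sub>0 where \<xi>\<^sub>0: "\<And>\<xi>. norm (fourier \<phi> \<xi>) \<le> norm (fourier \<phi> \<xi>\<^sub>0)"
    using fourier_attains_max[OF fin] by blast
  have A_eq: "norm (fourier \<phi> \<xi>\<^sub>0) = A"
    unfolding assms(2) by (rule cSup_eq_maximum[symmetric]) (use \<xi>\<^sub>0 in auto)
  have max: "norm (fourier \<phi> \<xi>) \<le> A" for \<xi> using \<xi>\<^sub>0 A_eq by simp
  have "A > 0"
  proof (rule ccontr)
    assume "\<not> A > 0"
    then have zero: "fourier \<phi> \<xi> = 0" for \<xi> using order_trans[OF max[of \<xi>], of 0] by simp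
    have "\<phi> x = 0" for x
      using has_integral_unique[OF fourier_inversion[OF fin, of x]] has_integral_0 by (force simp: zero)
    then show False using card by (simp add: supp_def)
  qed
  define u where "u = (\<lambda>\<xi>. fourier \<phi> \<xi> / of_real A)"
  define U where "U = (\<lambda>n x \<xi>. u \<xi>^n * exp (- (\<i> * of_int x * of_real \<xi>)))"
  have contu: "continuous_on S u" for S
    unfolding u_def fourier_eq_sum[OF fin order_refl] using \<open>A > 0\<close> by (intro continuous_intros) auto
  have intU: "U n x integrable_on {a..b}" for n x a b
    unfolding U_def by (intro integrable_continuous_real continuous_intros contu)
  define lower where "lower = (\<lambda>m. \<exists>c>0. \<forall>n\<ge>1.
    c * real n powr (- 1 / real m) \<le> sup_norm (conv_power \<phi> n) / A^n)"
  define upper where "upper = (\<lambda>m a b. \<exists>C>0. \<forall>n\<ge>1. \<forall>x.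
    norm (integral {a..b} (U n x)) \<le> C * real n powr (- 1 / real m))"
  have upper_mono: "upper m a b" if up: "upper l a b" and "1 \<le> l" "l \<le> m" for l m a b
  proof -
    obtain C where "C > 0" and C: "\<And>n x. n \<ge> 1 \<Longrightarrow>
        norm (integral {a..b} (U n x)) \<le> C * real n powr (- 1 / real l)"
      using up unfolding upper_def by blast
    have "norm (integral {a..b} (U n x)) \<le> C * real n powr (- 1 / real m)" if "n \<ge> 1" for n x
      using C[OF that, of x] mult_left_mono[OF powr_root_mono[OF that \<open>1 \<le> l\<close> \<open>l \<le> m\<close>], of C] \<open>C > 0\<close>
      by linarith
    then show ?thesis unfolding upper_def using \<open>C > 0\<close> by blast
  qed
  have upper_join: "upper m a c" if up: "upper m a b" "upper m b c" and "a \<le> b" "b \<le> c" for m a b c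
  proof -
    obtain C1 C2 where "C1 > 0" "C2 > 0"
      and C1: "\<And>n x. n \<ge> 1 \<Longrightarrow> norm (integral {a..b} (U n x)) \<le> C1 * real n powr (- 1 / real m)"
      and C2: "\<And>n x. n \<ge> 1 \<Longrightarrow> norm (integral {b..c} (U n x)) \<le> C2 * real n powr (- 1 / real m)"
      using up unfolding upper_def by blast
    have "norm (integral {a..c} (U n x)) \<le> (C1 + C2) * real n powr (- 1 / real m)" if "n \<ge> 1" for n x
    proof -
      have "integral {a..b} (U n x) + integral {b..c} (U n x) = integral {a..c} (U n x)"
        by (intro Henstock_Kurzweil_Integration.integral_combine intU) fact+
      then show ?thesis
        using norm_triangle_mono[OF C1[OF that, of x] C2[OF that, of x]] by (simp add: distrib_right)
    qed
    then show ?thesis unfolding upper_def using \<open>C1 > 0\<close> \<open>C2 > 0\<close> by (meson add_pos_pos)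
  qed
  have at_max: "\<exists>m\<ge>2. lower m \<and> (\<exists>d>0. \<forall>a b. a \<le> x \<and> x \<le> b \<and> b - a < d \<longrightarrow> upper m a b)"
    if "norm (fourier \<phi> x) = A" for x
  proof (rule bounds_at_max_point[OF assms(1) \<open>A > 0\<close> max that])
    fix m :: nat and c \<delta> C :: real
    assume m: "m \<ge> 2" and pos: "c > 0" "\<delta> > 0" "C > 0"
      and c: "\<And>n. n \<ge> (1::nat) \<Longrightarrow> c * real n powr (- 1 / real m) \<le> sup_norm (conv_power \<phi> n) / A^n"
      and C: "\<And>n a b y. n \<ge> (1::nat) \<Longrightarrow> a \<le> x \<Longrightarrow> x \<le> b \<Longrightarrow> b - a < \<delta> \<Longrightarrow>
        norm (integral {a..b} (\<lambda>\<xi>. (fourier \<phi> \<xi> / of_real A)^n * exp (- (\<i> * of_int y * of_real \<xi>))))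
          \<le> C * real n powr (- 1 / real m)"
    have "lower m" unfolding lower_def using pos(1) c by blast
    moreover have "upper m a b" if "a \<le> x" "x \<le> b" "b - a < \<delta>" for a b
      unfolding upper_def U_def u_def using pos(3) C[OF _ that] by blast
    ultimately show ?thesis using m pos(2) by blast
  qed
  \<comment> \<open>One maximum point provides an exponent with a lower bound for use at all other points.\<close>
  obtain m0 where m0: "m0 \<ge> 2" "lower m0" using at_max[OF A_eq] by blast
  have "\<exists>m\<ge>2. lower m \<and> upper m 0 (2 * pi)"
  proof (rule Bolzano[of 0 "2 * pi" "\<lambda>a b. \<exists>m\<ge>2. lower m \<and> upper m a b"])
    fix a b c :: real
    assume "\<exists>m\<ge>2. lower m \<and> upper m a b" "\<exists>m\<ge>2. lower m \<and> upper m b c" and abc: "a \<le> b" "b \<le> c"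
    then obtain l m where lm: "l \<ge> 2" "lower l" "upper l a b" "m \<ge> 2" "lower m" "upper m b c" by blast
    have "upper (max l m) a b" "upper (max l m) b c"
      using lm(1,4) by (auto intro: upper_mono[OF lm(3)] upper_mono[OF lm(6)])
    from upper_join[OF this abc] have "upper (max l m) a c" .
    moreover have "lower (max l m)" using lm(2,5) by (cases "l \<le> m") simp_all
    moreover have "max l m \<ge> 2" using lm(1) by simp
    ultimately show "\<exists>m\<ge>2. lower m \<and> upper m a c" by blast
  next
    fix x :: real
    show "\<exists>d>0. \<forall>a b. a \<le> x \<and> x \<le> b \<and> b - a < d \<longrightarrow> (\<exists>m\<ge>2. lower m \<and> upper m a b)"
    proof (cases "norm (fourier \<phi> x) = A")
      case True
      then show ?thesis using at_max by blast
    next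
      case False
      then have "norm (u x) < 1" using max[of x] \<open>A > 0\<close> by (simp add: u_def norm_divide)
      then show ?thesis
      proof (rule bound_away_from_max[OF contu _ m0(1)])
        fix \<delta> C :: real
        assume pos: "\<delta> > 0" "C > 0"
          and C: "\<And>n a b y. n \<ge> (1::nat) \<Longrightarrow> a \<le> x \<Longrightarrow> x \<le> b \<Longrightarrow> b - a < \<delta> \<Longrightarrow>
            norm (integral {a..b} (\<lambda>\<xi>. u \<xi>^n * exp (- (\<i> * of_int y * of_real \<xi>))))
              \<le> C * real n powr (- 1 / real m0)"
        have "upper m0 a b" if "a \<le> x" "x \<le> b" "b - a < \<delta>" for a b
          unfolding upper_def U_def using pos(2) C[OF _ that] by blast
        then show ?thesis using m0 pos(1) by blast
      qed
    qed
  qed simp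
  then obtain m c C where m: "m \<ge> 2" and cC: "c > 0" "C > 0"
    and c: "\<And>n. n \<ge> 1 \<Longrightarrow> c * real n powr (- 1 / real m) \<le> sup_norm (conv_power \<phi> n) / A^n"
    and C: "\<And>n x. n \<ge> 1 \<Longrightarrow> norm (integral {0..2 * pi} (U n x)) \<le> C * real n powr (- 1 / real m)"
    unfolding lower_def upper_def by blast
  have sup: "sup_norm (conv_power \<phi> n) / A^n \<le> C / (2 * pi) * real n powr (- 1 / real m)" if n: "n \<ge> 1" for n
  proof -
    have "norm (conv_power \<phi> n x) \<le> A^n * (C / (2 * pi) * real n powr (- 1 / real m))" for x
    proof -
      have "(\<lambda>\<xi>. fourier (conv_power \<phi> n) \<xi> * exp (- (\<i> * of_int x * of_real \<xi>))) =
          (\<lambda>\<xi>. of_real (A^n) * U n x \<xi>)"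
        using \<open>A > 0\<close> by (auto simp: fourier_conv_power[OF fin] U_def u_def power_divide)
      then have "2 * pi * conv_power \<phi> n x = of_real (A^n) * integral {0..2 * pi} (U n x)"
        using integral_unique[OF fourier_inversion[OF finite_supp_conv_power[OF fin], of n x]] by simp
      from arg_cong[OF this, of norm]
      have "2 * pi * norm (conv_power \<phi> n x) = A^n * norm (integral {0..2 * pi} (U n x))"
        using \<open>A > 0\<close> by (simp add: norm_mult norm_power)
      also have "\<dots> \<le> A^n * (C * real n powr (- 1 / real m))"
        using \<open>A > 0\<close> C[OF n] by (intro mult_left_mono) auto
      finally show ?thesis by (simp add: field_simps)
    qed
    then have "sup_norm (conv_power \<phi> n) \<le> A^n * (C / (2 * pi) * real n powr (- 1 / real m))"
      unfolding sup_norm_def by (intro cSUP_least) auto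
    then show ?thesis using \<open>A > 0\<close> by (simp add: pos_divide_le_eq mult_ac)
  qed
  have powi: "A powi (- int n) * s = s / A^n" for n s
    by (simp add: power_int_minus divide_inverse mult.commute)
  show ?thesis
    unfolding powi using m cC c sup
    by (intro exI[of _ m] conjI exI[of _ c] exI[of _ "C / (2 * pi)"] allI impI) auto
qed

end
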